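(* Let $(\mathbb{S},\mathbb{P})$ be an $S$-structure. The order complex $\Delta(\mathcal{V}_{\mathbb{S}})$ is a contractible $\Gamma_S$-complex. For each non-empty $Y\subseteq X$ that is a finite disjoint union of domains, the order complex $\Delta(\mathcal{PV}_{\mathbb{S},Y})$ is contractible.
   Context: Setting. $X$ is a non-empty set. A partial bijection of $X$ is a bijection $f:A\to B$ between (possibly empty) subsets of $X$; for partial bijections $f:A\to B$, $g:C\to D$ the composition $gf$ is the partial bijection $f^{-1}(C)\to g(B\cap C)$, $x\mapsto g(f(x))$. $S$ is a set of partial bijections of $X$ closed under composition and inverses and containing the empty function. A domain is a set that is the domain of some $s\in S$; $\mathcal{D}^{+}$ is the set of non-empty domains. It is assumed that $X$ is a finite disjoint union of domains. $\widehat{S}$ is the set of all partial bijections $\hat s:A\to B$ of $X$ for which there are $m\ge 0$ and finite disjoint unions $A=\coprod_{i=1}^m D_i$, $B=\coprod_{i=1}^m E_i$ with each $\hat s_{|D_i}$ a bijection $D_i\to E_i$ belonging to $S$. An injective map $f:D\to X$ is locally determined by $S$ if $f:D\to f(D)$ belongs to $\widehat{S}$. $\Gamma_S$ is the group (under composition) of bijections $X\to X$ belonging to $\widehat{S}$. $S$-structures. For a partition $\mathcal{P}$ of $D$ and $E\subseteq D$, $\mathcal{P}_{|E}=\{P\cap E: P\in\mathcal{P},\,P\cap E\ne\emptyset\}$. An $S$-structure is a pair $(\mathbb{S},\mathbb{P})$, where $\mathbb{S}$ assigns to each $(D_1,D_2)\in\mathcal{D}^{+}\times\mathcal{D}^{+}$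 a subset $\mathbb{S}(D_1,D_2)\subseteq S$ and $\mathbb{P}$ assigns to each $D\in\mathcal{D}^{+}$ a collection $\mathbb{P}(D)$ of partitions of $D$, such that: (P1) $\{D\}\in\mathbb{P}(D)$; (P2) each $\mathcal{P}\in\mathbb{P}(D)$ is a finite partition of $D$ into domains; (P3) if $\mathcal{P}\in\mathbb{P}(D)$ and $E\subseteq D$ is a non-empty domain, then $\mathcal{P}_{|E}\in\mathbb{P}(E)$; (P4) if $\{D_1,\dots,D_m\}\in\mathbb{P}(D)$ and $\mathcal{P}_i\in\mathbb{P}(D_i)$ for each $i$, then $\mathcal{P}_1\cup\dots\cup\mathcal{P}_m\in\mathbb{P}(D)$; (P5) every finite partition of $D\in\mathcal{D}^{+}$ into domains is refined by some $\mathcal{P}\in\mathbb{P}(D)$; (S1) each $s\in\mathbb{S}(D_1,D_2)$ has domain $D_1$ and image $D_2$; (S2) $\mathrm{id}_D\in\mathbb{S}(D,D)$; (S3) $s\in\mathbb{S}(D_1,D_2)$ implies $s^{-1}\in\mathbb{S}(D_2,D_1)$; (S4) $s_1\in\mathbb{S}(D_1,D_2)$ and $s_2\in\mathbb{S}(D_2,D_3)$ imply $s_2s_1\in\mathbb{S}(D_1,D_3)$; (S5) if $D\in\mathcal{D}^{+}$ and $f:D\to X$ is locally determined by $S$, there is $\mathcal{P}\in\mathbb{P}(D)$ such that for each $E\in\mathcal{P}$, $f_{|E}:E\to f(E)$ is an element of $S$ lying in $\mathbb{S}(E,f(E))$; (S6) if $\mathcal{P}\in\mathbb{P}(D_1)$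 and $s\in\mathbb{S}(D_1,D_2)$, then $s(\mathcal{P})\in\mathbb{P}(D_2)$. Pseudovertices. On the set of pairs $(f,D)$ with $D\in\mathcal{D}^{+}$ and $f:D\to X$ locally determined by $S$, put $(f_1,D_1)\sim(f_2,D_2)$ if $f_1=f_2h$ for some $h\in\mathbb{S}(D_1,D_2)$. $[f,D]$ is the class of $(f,D)$, and $\mathcal{B}$ the set of classes; if $g$ is defined on a set containing $D$, $[g,D]$ means $[g_{|D},D]$. A pseudovertex is a finite non-empty subset $v=\{[f_1,D_1],\dots,[f_m,D_m]\}$ of $\mathcal{B}$ whose images $f_i(D_i)$ are pairwise disjoint; $im(v)=\bigcup_i f_i(D_i)$. $\mathcal{PV}_{\mathbb{S},Y}$ is the set of pseudovertices with image $Y$, and $\mathcal{V}_{\mathbb{S}}=\mathcal{PV}_{\mathbb{S},X}$. Expansion: $v\nearrow v'$ if $v'=(v-\{[f,D]\})\cup\{[fh,E]: E\in\mathcal{P}\}$ for some $[f,D]\in v$, some $\widehat{D}\in\mathcal{D}^{+}$, some $h\in\mathbb{S}(\widehat{D},D)$, and some $\mathcal{P}\in\mathbb{P}(\widehat{D})$ with $|\mathcal{P}|\ge 2$. Write $v\le v'$ if $v'$ is obtained from $v$ by a finite (possibly empty) sequence of expansions; this is a partial order. $\Gamma_S$ acts on $\mathcal{V}_{\mathbb{S}}$ by $\gamma\cdot\{[f_i,D_i]\}_i=\{[\gamma f_i,D_i]\}_i$. The order complex $\Delta(P)$ of a partially ordered set $P$ is the simplicial complex with vertex set $P$ whose simplices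 are the non-empty finite chains of $P$. A $\Gamma_S$-complex is a simplicial complex with a simplicial action of $\Gamma_S$ (here, the one induced by the action on $\mathcal{V}_{\mathbb{S}}$). *)

theory Defs
  imports "HOL-Analysis.Analysis" "HOL-Algebra.Group_Action" "HOL-Library.Disjoint_Sets"
begin

section \<open>Partial bijections\<close>

text \<open>
  A partial bijection \<open>f : A \<rightarrow> B\<close> is represented by its graph, so \<open>A = Domain f\<close>,
  \<open>B = Range f\<close>, the inverse is \<open>f\<inverse>\<close>, and the composite \<open>gf\<close> (first \<open>f\<close>, then \<open>g\<close>) is the
  relational composite \<open>f O g\<close>: note the reversed order.
\<close>

definition partial_bij :: "'a set \<Rightarrow> ('a \<times> 'a) set \<Rightarrow> bool" where
  "partial_bij X f \<longleftrightarrow> f \<subseteq> X \<times> X \<and> single_valued f \<and> single_valued (f\<inverse>)"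

definition restr :: "('a \<times> 'a) set \<Rightarrow> 'a set \<Rightarrow> ('a \<times> 'a) set" where
  "restr f E = f \<inter> (E \<times> UNIV)"

definition domains :: "('a \<times> 'a) set set \<Rightarrow> 'a set set" where
  "domains S = Domain ` S"

definition ne_domains :: "('a \<times> 'a) set set \<Rightarrow> 'a set set" where
  "ne_domains S = domains S - {{}}"

definition finite_disjoint_union_of_domains :: "('a \<times> 'a) set set \<Rightarrow> 'a set \<Rightarrow> bool" where
  "finite_disjoint_union_of_domains S Y \<longleftrightarrow>
     (\<exists>(m::nat) D. disjoint_family_on D {1..m} \<and> (\<forall>i\<in>{1..m}. D i \<in> domains S) \<and>
        Y = (\<Union>i\<in>{1..m}. D i))"

definition hat :: "'a set \<Rightarrow> ('a \<times> 'a) set set \<Rightarrow> ('a \<times> 'a) set set" where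
  "hat X S = {s. partial_bij X s \<and>
     (\<exists>(m::nat) D E.
        disjoint_family_on D {1..m} \<and> Domain s = (\<Union>i\<in>{1..m}. D i) \<and>
        disjoint_family_on E {1..m} \<and> Range s = (\<Union>i\<in>{1..m}. E i) \<and>
        (\<forall>i\<in>{1..m}. restr s (D i) \<in> S \<and> Range (restr s (D i)) = E i))}"

text \<open>Injectivity of \<open>f : D \<rightarrow> X\<close> is part of \<open>f \<in> hat X S\<close>.\<close>

definition locally_determined ::
    "'a set \<Rightarrow> ('a \<times> 'a) set set \<Rightarrow> ('a \<times> 'a) set \<Rightarrow> 'a set \<Rightarrow> bool" where
  "locally_determined X S f D \<longleftrightarrow> Domain f = D \<and> f \<in> hat X S"

definition GammaS :: "'a set \<Rightarrow> ('a \<times> 'a) set set \<Rightarrow> ('a \<times> 'a) set monoid" where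
  "GammaS X S = \<lparr>carrier = {\<gamma> \<in> hat X S. Domain \<gamma> = X \<and> Range \<gamma> = X},
                 mult = (\<lambda>\<gamma> \<delta>. \<delta> O \<gamma>),
                 one = Id_on X\<rparr>"

locale partial_bijection_system =
  fixes X :: "'a set" and S :: "('a \<times> 'a) set set"
  assumes X_nonempty: "X \<noteq> {}"
    and partial_bij: "s \<in> S \<Longrightarrow> partial_bij X s"
    and comp_closed: "\<lbrakk>s \<in> S; t \<in> S\<rbrakk> \<Longrightarrow> s O t \<in> S"
    and inverse_closed: "s \<in> S \<Longrightarrow> s\<inverse> \<in> S"
    and empty_mem: "{} \<in> S"
    and X_union_of_domains: "finite_disjoint_union_of_domains S X"

section \<open>S-structures\<close>

definition restr_partition :: "'a set set \<Rightarrow> 'a set \<Rightarrow> 'a set set" where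
  "restr_partition \<P> E = {P \<inter> E |P. P \<in> \<P> \<and> P \<inter> E \<noteq> {}}"

text \<open>
  The values of \<open>SS\<close> and \<open>PP\<close> matter only on non-empty domains. In (P4) the partitions
  \<open>\<P>\<^sub>i \<in> PP D\<^sub>i\<close> are given by a function \<open>Q\<close> indexed by the blocks \<open>D\<^sub>i\<close> themselves.
\<close>

locale S_structure = partial_bijection_system X S
  for X :: "'a set" and S :: "('a \<times> 'a) set set" +
  fixes SS :: "'a set \<Rightarrow> 'a set \<Rightarrow> ('a \<times> 'a) set set"
    and PP :: "'a set \<Rightarrow> 'a set set set"
  assumes SS_subset:
      "\<lbrakk>D1 \<in> ne_domains S; D2 \<in> ne_domains S\<rbrakk> \<Longrightarrow> SS D1 D2 \<subseteq> S"
    and P1: "D \<in> ne_domains S \<Longrightarrow> {D} \<in> PP D"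
    and P2: "\<lbrakk>D \<in> ne_domains S; \<P> \<in> PP D\<rbrakk> \<Longrightarrow>
               finite \<P> \<and> partition_on D \<P> \<and> \<P> \<subseteq> domains S"
    and P3: "\<lbrakk>D \<in> ne_domains S; \<P> \<in> PP D; E \<in> ne_domains S; E \<subseteq> D\<rbrakk> \<Longrightarrow>
               restr_partition \<P> E \<in> PP E"
    and P4: "\<lbrakk>D \<in> ne_domains S; \<P> \<in> PP D; \<And>E. E \<in> \<P> \<Longrightarrow> Q E \<in> PP E\<rbrakk> \<Longrightarrow>
               (\<Union>E\<in>\<P>. Q E) \<in> PP D"
    and P5: "\<lbrakk>D \<in> ne_domains S; finite \<Q>; partition_on D \<Q>; \<Q> \<subseteq> domains S\<rbrakk> \<Longrightarrow>
               \<exists>\<P>\<in>PP D. refines D \<P> \<Q>"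
    and S1: "\<lbrakk>D1 \<in> ne_domains S; D2 \<in> ne_domains S; s \<in> SS D1 D2\<rbrakk> \<Longrightarrow>
               Domain s = D1 \<and> Range s = D2"
    and S2: "D \<in> ne_domains S \<Longrightarrow> Id_on D \<in> SS D D"
    and S3: "\<lbrakk>D1 \<in> ne_domains S; D2 \<in> ne_domains S; s \<in> SS D1 D2\<rbrakk> \<Longrightarrow> s\<inverse> \<in> SS D2 D1"
    and S4: "\<lbrakk>D1 \<in> ne_domains S; D2 \<in> ne_domains S; D3 \<in> ne_domains S;
               s1 \<in> SS D1 D2; s2 \<in> SS D2 D3\<rbrakk> \<Longrightarrow> s1 O s2 \<in> SS D1 D3"
    and S5: "\<lbrakk>D \<in> ne_domains S; locally_determined X S f D\<rbrakk> \<Longrightarrow>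
               \<exists>\<P>\<in>PP D. \<forall>E\<in>\<P>. restr f E \<in> S \<and> restr f E \<in> SS E (f `` E)"
    and S6: "\<lbrakk>D1 \<in> ne_domains S; D2 \<in> ne_domains S; \<P> \<in> PP D1; s \<in> SS D1 D2\<rbrakk> \<Longrightarrow>
               (\<lambda>E. s `` E) ` \<P> \<in> PP D2"

section \<open>Pseudovertices\<close>

type_synonym 'a pair_class = "(('a \<times> 'a) set \<times> 'a set) set"

definition ld_pairs :: "'a set \<Rightarrow> ('a \<times> 'a) set set \<Rightarrow> (('a \<times> 'a) set \<times> 'a set) set" where
  "ld_pairs X S = {(f, D). D \<in> ne_domains S \<and> locally_determined X S f D}"

definition pair_rel :: "'a set \<Rightarrow> ('a \<times> 'a) set set \<Rightarrow> ('a set \<Rightarrow> 'a set \<Rightarrow> ('a \<times> 'a) set set) \<Rightarrow>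
    ((('a \<times> 'a) set \<times> 'a set) \<times> (('a \<times> 'a) set \<times> 'a set)) set" where
  "pair_rel X S SS = {((f1, D1), (f2, D2)).
     (f1, D1) \<in> ld_pairs X S \<and> (f2, D2) \<in> ld_pairs X S \<and> (\<exists>h\<in>SS D1 D2. f1 = h O f2)}"

text \<open>\<open>cls X S SS g D\<close> is \<open>[g, D]\<close>, where \<open>g\<close> may be defined on a set larger than \<open>D\<close>.\<close>

definition cls :: "'a set \<Rightarrow> ('a \<times> 'a) set set \<Rightarrow> ('a set \<Rightarrow> 'a set \<Rightarrow> ('a \<times> 'a) set set) \<Rightarrow>
    ('a \<times> 'a) set \<Rightarrow> 'a set \<Rightarrow> 'a pair_class" where
  "cls X S SS g D = pair_rel X S SS `` {(restr g D, D)}"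

definition pair_classes :: "'a set \<Rightarrow> ('a \<times> 'a) set set \<Rightarrow>
    ('a set \<Rightarrow> 'a set \<Rightarrow> ('a \<times> 'a) set set) \<Rightarrow> 'a pair_class set" where
  "pair_classes X S SS = ld_pairs X S // pair_rel X S SS"

text \<open>Equivalent pairs have the same image, so this is \<open>f(D)\<close> for the class \<open>[f, D]\<close>.\<close>

definition class_im :: "'a pair_class \<Rightarrow> 'a set" where
  "class_im b = (\<Union>(f, D)\<in>b. f `` D)"

definition pseudovertex :: "'a set \<Rightarrow> ('a \<times> 'a) set set \<Rightarrow>
    ('a set \<Rightarrow> 'a set \<Rightarrow> ('a \<times> 'a) set set) \<Rightarrow> 'a pair_class set \<Rightarrow> bool" where
  "pseudovertex X S SS v \<longleftrightarrow>
     finite v \<and> v \<noteq> {} \<and> v \<subseteq> pair_classes X S SS \<and> disjoint_family_on class_im v"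

definition im :: "'a pair_class set \<Rightarrow> 'a set" where
  "im v = (\<Union>b\<in>v. class_im b)"

definition PV :: "'a set \<Rightarrow> ('a \<times> 'a) set set \<Rightarrow> ('a set \<Rightarrow> 'a set \<Rightarrow> ('a \<times> 'a) set set) \<Rightarrow>
    'a set \<Rightarrow> 'a pair_class set set" where
  "PV X S SS Y = {v. pseudovertex X S SS v \<and> im v = Y}"

definition VS :: "'a set \<Rightarrow> ('a \<times> 'a) set set \<Rightarrow> ('a set \<Rightarrow> 'a set \<Rightarrow> ('a \<times> 'a) set set) \<Rightarrow>
    'a pair_class set set" where
  "VS X S SS = PV X S SS X"

definition expansion :: "'a set \<Rightarrow> ('a \<times> 'a) set set \<Rightarrow>
    ('a set \<Rightarrow> 'a set \<Rightarrow> ('a \<times> 'a) set set) \<Rightarrow> ('a set \<Rightarrow> 'a set set set) \<Rightarrow>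
    ('a pair_class set \<times> 'a pair_class set) set" where
  "expansion X S SS PP = {(v, v'). pseudovertex X S SS v \<and> pseudovertex X S SS v' \<and>
     (\<exists>f D D' h \<P>. (f, D) \<in> ld_pairs X S \<and> cls X S SS f D \<in> v \<and>
        D' \<in> ne_domains S \<and> h \<in> SS D' D \<and> \<P> \<in> PP D' \<and> card \<P> \<ge> 2 \<and>
        v' = (v - {cls X S SS f D}) \<union> {cls X S SS (h O f) E |E. E \<in> \<P>})}"

definition expansion_le :: "'a set \<Rightarrow> ('a \<times> 'a) set set \<Rightarrow>
    ('a set \<Rightarrow> 'a set \<Rightarrow> ('a \<times> 'a) set set) \<Rightarrow> ('a set \<Rightarrow> 'a set set set) \<Rightarrow>
    ('a pair_class set \<times> 'a pair_class set) set" where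
  "expansion_le X S SS PP = (expansion X S SS PP)\<^sup>*"

text \<open>
  \<open>\<gamma> \<cdot> {[f\<^sub>1, D\<^sub>1], \<dots>} = {[\<gamma>f\<^sub>1, D\<^sub>1], \<dots>}\<close>, taken over all representatives of the members of \<open>v\<close>;
  distinct classes with the same non-empty image cannot lie in one pseudovertex, so that
  the result is a pseudovertex amounts to independence of the representatives.
\<close>

definition act :: "'a set \<Rightarrow> ('a \<times> 'a) set set \<Rightarrow> ('a set \<Rightarrow> 'a set \<Rightarrow> ('a \<times> 'a) set set) \<Rightarrow>
    ('a \<times> 'a) set \<Rightarrow> 'a pair_class set \<Rightarrow> 'a pair_class set" where
  "act X S SS \<gamma> v =
     {cls X S SS (f O \<gamma>) D |f D. (f, D) \<in> ld_pairs X S \<and> cls X S SS f D \<in> v}"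

section \<open>Abstract simplicial complexes and their geometric realizations\<close>

definition abstract_complex :: "'v set \<Rightarrow> 'v set set \<Rightarrow> bool" where
  "abstract_complex V K \<longleftrightarrow>
     (\<forall>\<sigma>\<in>K. finite \<sigma> \<and> \<sigma> \<noteq> {} \<and> \<sigma> \<subseteq> V) \<and>
     (\<forall>v\<in>V. {v} \<in> K) \<and>
     (\<forall>\<sigma>\<in>K. \<forall>\<tau>. \<tau> \<subseteq> \<sigma> \<longrightarrow> \<tau> \<noteq> {} \<longrightarrow> \<tau> \<in> K)"

definition order_complex :: "'v set \<Rightarrow> ('v \<times> 'v) set \<Rightarrow> 'v set set" where
  "order_complex P r = {C. C \<subseteq> P \<and> finite C \<and> C \<noteq> {} \<and> C \<in> Chains r}"

text \<open>\<open>\<phi>\<close> is an action of \<open>G\<close> on the vertex set \<open>V\<close> that is simplicial for \<open>K\<close>.\<close>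

definition G_complex :: "('g, 'm) monoid_scheme \<Rightarrow> 'v set \<Rightarrow> 'v set set \<Rightarrow>
    ('g \<Rightarrow> 'v \<Rightarrow> 'v) \<Rightarrow> bool" where
  "G_complex G V K \<phi> \<longleftrightarrow> abstract_complex V K \<and> group G \<and> group_action G V \<phi> \<and>
     (\<forall>g\<in>carrier G. \<forall>\<sigma>\<in>K. \<phi> g ` \<sigma> \<in> K)"

text \<open>Points of the realization are given by their barycentric coordinates.\<close>

definition closed_simplex :: "'v set \<Rightarrow> ('v \<Rightarrow> real) set" where
  "closed_simplex \<sigma> = {t. (\<forall>v. 0 \<le> t v) \<and> (\<forall>v. v \<notin> \<sigma> \<longrightarrow> t v = 0) \<and> (\<Sum>v\<in>\<sigma>. t v) = 1}"

definition realization_points :: "'v set set \<Rightarrow> ('v \<Rightarrow> real) set" where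
  "realization_points K = (\<Union>\<sigma>\<in>K. closed_simplex \<sigma>)"

text \<open>
  The weak (coherent) topology: a set is open iff its intersection with each closed simplex
  is open in the Euclidean topology of that simplex.
\<close>

definition realization :: "'v set set \<Rightarrow> ('v \<Rightarrow> real) topology" where
  "realization K = topology (\<lambda>U. U \<subseteq> realization_points K \<and>
     (\<forall>\<sigma>\<in>K. openin (subtopology (powertop_real UNIV) (closed_simplex \<sigma>))
                    (U \<inter> closed_simplex \<sigma>)))"

lemma openin_realization:
  "openin (realization K) U \<longleftrightarrow> U \<subseteq> realization_points K \<and>
     (\<forall>\<sigma>\<in>K. openin (subtopology (powertop_real UNIV) (closed_simplex \<sigma>))
                    (U \<inter> closed_simplex \<sigma>))"
proof -
  let ?T = "\<lambda>\<sigma>. subtopology (powertop_real UNIV) (closed_simplex \<sigma>)"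
  let ?L = "\<lambda>U. U \<subseteq> realization_points K \<and> (\<forall>\<sigma>\<in>K. openin (?T \<sigma>) (U \<inter> closed_simplex \<sigma>))"
  have "istopology ?L"
    unfolding istopology_def
  proof (intro conjI allI impI)
    fix U V assume U: "?L U" and V: "?L V"
    show "U \<inter> V \<subseteq> realization_points K" using U by blast
    show "\<forall>\<sigma>\<in>K. openin (?T \<sigma>) (U \<inter> V \<inter> closed_simplex \<sigma>)"
    proof
      fix \<sigma> assume "\<sigma> \<in> K"
      then have "openin (?T \<sigma>) ((U \<inter> closed_simplex \<sigma>) \<inter> (V \<inter> closed_simplex \<sigma>))"
        using U V by (blast intro: openin_Int[of "?T \<sigma>"])
      moreover have "(U \<inter> closed_simplex \<sigma>) \<inter> (V \<inter> closed_simplex \<sigma>) = U \<inter> V \<inter> closed_simplex \<sigma>"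
        by blast
      ultimately show "openin (?T \<sigma>) (U \<inter> V \<inter> closed_simplex \<sigma>)" by simp
    qed
  next
    fix \<U> assume \<U>: "\<forall>U\<in>\<U>. ?L U"
    show "\<Union>\<U> \<subseteq> realization_points K" using \<U> by blast
    show "\<forall>\<sigma>\<in>K. openin (?T \<sigma>) (\<Union>\<U> \<inter> closed_simplex \<sigma>)"
    proof
      fix \<sigma> assume "\<sigma> \<in> K"
      then have "openin (?T \<sigma>) (\<Union>U\<in>\<U>. U \<inter> closed_simplex \<sigma>)"
        using \<U> by (intro openin_Union) auto
      moreover have "(\<Union>U\<in>\<U>. U \<inter> closed_simplex \<sigma>) = \<Union>\<U> \<inter> closed_simplex \<sigma>" by blast
      ultimately show "openin (?T \<sigma>) (\<Union>\<U> \<inter> closed_simplex \<sigma>)" by simp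
    qed
  qed
  then show ?thesis
    unfolding realization_def by (simp add: topology_inverse')
qed

text \<open>The library's \<open>contractible_space\<close> holds for the empty space, which is excluded here.\<close>

definition contractible_complex :: "'v set set \<Rightarrow> bool" where
  "contractible_complex K \<longleftrightarrow>
     topspace (realization K) \<noteq> {} \<and> contractible_space (realization K)"

end

theory Submission
  imports Defs
begin

text \<open>
  The order complex of a non-empty directed preordered set is contractible
  (\<open>contractible_order_complex_directed\<close>), and the pseudovertices with a given image are directed under
  expansion (\<open>PV_directed\<close>). The group acts simplicially since it composes on the left, whereas the
  equivalence of pairs and the expansions are defined by composing and restricting on the right
  (\<open>act_expansion\<close>).

  For directedness, each class \<open>[f, D]\<close> can by (S5) be cut along some \<open>\<P> \<in> PP D\<close> into pieces \<open>f|\<^sub>E\<close>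
  that are members of \<open>SS E (f(E))\<close>; such a piece represents the class \<open>[id, f(E)]\<close>
  (\<open>class_refined_by_std\<close>). So every pseudovertex lies below a standard one \<open>{[id, E] | E \<in> \<Q>}\<close>, where
  \<open>\<Q>\<close> is a finite partition of the image into domains. It remains to bound the standard pseudovertices
  of two partitions \<open>\<Q>\<close> and \<open>\<Q>'\<close> (\<open>std_common_upper_bound\<close>). By (P5) expand \<open>\<Q>\<close> to a partition \<open>\<A>\<close> each
  of whose blocks lies in a block of \<open>\<Q>'\<close>, and then expand \<open>\<Q>'\<close> to a partition \<open>\<R>\<close> each of whose blocks
  lies in a block of \<open>\<A>\<close>. Two rounds are enough: a block \<open>D\<close> of \<open>\<A>\<close> lies in one block \<open>F\<close> of \<open>\<Q>'\<close>, so
  the blocks of \<open>\<R>\<close> inside \<open>D\<close> are the restriction to \<open>D\<close> of the member of \<open>PP F\<close> used for \<open>F\<close>, and this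
  restriction is in \<open>PP D\<close> by (P3). Hence \<open>\<R>\<close> is an expansion of \<open>\<A>\<close> as well.

  For contractibility, let \<open>P\<close> be directed with base point \<open>b\<close>. Choose for each finite \<open>A \<subseteq> P\<close> an upper
  bound \<open>u A \<ge> b\<close>, monotone in \<open>A\<close> (\<open>directed_monotone_upper_bounds\<close>). A point \<open>x\<close> of the realization
  is a function on \<open>P\<close>, and it is the integral over all levels \<open>c > 0\<close> of the indicator functions of its
  superlevel sets \<open>L\<^sub>c = {v. c \<le> x v}\<close>, which decrease as \<open>c\<close> grows. At time \<open>s\<close>, replace for every
  \<open>c \<le> s\<close> the indicator of \<open>L\<^sub>c\<close> by the same total mass concentrated at the vertex \<open>u L\<^sub>c\<close>. The vertices
  in use at time \<open>s\<close> are the \<open>v\<close> with \<open>x v > s\<close> and the \<open>u L\<^sub>c\<close> with \<open>c \<le> s\<close>. The latter form a chain as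
  \<open>u\<close> is monotone, and they lie above the former, since \<open>v \<in> L\<^sub>c\<close> when \<open>c \<le> s < x v\<close>. So the point
  stays in the complex. At time 1 only vertices above \<open>b\<close> are left, and a straight line leads to \<open>b\<close>.

  Continuity in the weak topology costs little: the realization is a quotient of the disjoint union of
  its simplices, this remains so after multiplication with the compact interval, and on one simplex
  the flow takes values in a finite subcomplex and has coordinates that are built from minima, maxima
  and sums.
\<close>

section \<open>The weak topology\<close>

lemma topspace_realization [simp]: "topspace (realization K) = realization_points K"
proof -
  have "openin (realization K) (realization_points K)"
    unfolding openin_realization
  proof (intro conjI ballI)
    fix \<sigma> assume "\<sigma> \<in> K"
    then have "realization_points K \<inter> closed_simplex \<sigma> = closed_simplex \<sigma>"
      by (auto simp: realization_points_def)
    then show "openin (subtopology (powertop_real UNIV) (closed_simplex \<sigma>))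
        (realization_points K \<inter> closed_simplex \<sigma>)"
      by (simp add: openin_subtopology_refl)
  qed simp
  then have "realization_points K \<subseteq> topspace (realization K)"
    by (rule openin_subset)
  moreover have "topspace (realization K) \<subseteq> realization_points K"
    using openin_topspace[of "realization K"] unfolding openin_realization by blast
  ultimately show ?thesis by blast
qed

abbreviation simplex_space :: "'v set \<Rightarrow> ('v \<Rightarrow> real) topology" where
  "simplex_space \<sigma> \<equiv> subtopology (powertop_real UNIV) (closed_simplex \<sigma>)"

text \<open>
  The universal property of the weak topology, in the form in which it survives taking a product with
  a locally compact space.
\<close>

lemma quotient_map_simplices_realization:
  "quotient_map (sum_topology simplex_space K) (realization K) snd"
  unfolding quotient_map_def
proof (intro conjI allI impI)
  show "snd ` topspace (sum_topology simplex_space K) = topspace (realization K)"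
    by (force simp: realization_points_def)
  fix U assume "U \<subseteq> topspace (realization K)"
  moreover have "{x. (\<sigma>, x) \<in> {z \<in> topspace (sum_topology simplex_space K). snd z \<in> U}} = U \<inter> closed_simplex \<sigma>"
    if "\<sigma> \<in> K" for \<sigma> using that by auto
  ultimately show "openin (sum_topology simplex_space K)
          {z \<in> topspace (sum_topology simplex_space K). snd z \<in> U} = openin (realization K) U"
    by (simp add: openin_sum_topology openin_realization Collect_case_prod_Sigma subset_iff)
qed

lemma continuous_map_prod_sum_topology:
  assumes "\<And>i. i \<in> I \<Longrightarrow> continuous_map (prod_topology Z (X i)) W (\<lambda>(z, x). f (z, (i, x)))"
  shows "continuous_map (prod_topology Z (sum_topology X I)) W f"
  unfolding continuous_map_def
proof (intro conjI allI impI)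
  show "f \<in> topspace (prod_topology Z (sum_topology X I)) \<rightarrow> topspace W"
  proof
    fix p assume "p \<in> topspace (prod_topology Z (sum_topology X I))"
    then obtain z i x where p: "p = (z, (i, x))" "z \<in> topspace Z" "i \<in> I" "x \<in> topspace (X i)"
      by auto
    then have "(\<lambda>(z, x). f (z, (i, x))) (z, x) \<in> topspace W"
      using funcset_mem[OF continuous_map_funspace[OF assms[OF p(3)]], of "(z, x)"] by simp
    then show "f p \<in> topspace W" using p(1) by simp
  qed
  fix U assume U: "openin W U"
  show "openin (prod_topology Z (sum_topology X I)) {p \<in> topspace (prod_topology Z (sum_topology X I)). f p \<in> U}"
    unfolding openin_prod_topology_alt
  proof (intro allI impI)
    fix z y assume "(z, y) \<in> {p \<in> topspace (prod_topology Z (sum_topology X I)). f p \<in> U}"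
    then obtain i x where y: "y = (i, x)" "i \<in> I" "x \<in> topspace (X i)" "z \<in> topspace Z" "f (z, y) \<in> U"
      by auto
    let ?V = "{q \<in> topspace (prod_topology Z (X i)). (\<lambda>(z, x). f (z, (i, x))) q \<in> U}"
    have V: "openin (prod_topology Z (X i)) ?V"
      using assms[OF y(2)] U unfolding continuous_map_def by blast
    have zx: "(z, x) \<in> ?V" using y by simp
    obtain A B where AB: "openin Z A" "openin (X i) B" "z \<in> A" "x \<in> B" "A \<times> B \<subseteq> ?V"
      using openin_prod_topology_alt[THEN iffD1, rule_format, OF V zx] by (elim exE conjE)
    have "openin (sum_topology X I) (Pair i ` B)"
      using open_map_component_injection[OF y(2), of X] AB(2) by (simp add: open_map_def)
    moreover have "A \<times> Pair i ` B \<subseteq> {p \<in> topspace (prod_topology Z (sum_topology X I)). f p \<in> U}"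
    proof clarsimp
      fix z' x' assume "z' \<in> A" "x' \<in> B"
      then have "(z', x') \<in> ?V" using AB(5) by blast
      then show "z' \<in> topspace Z \<and> i \<in> I \<and> x' \<in> topspace (X i) \<and> f (z', i, x') \<in> U"
        using y(2) by simp
    qed
    ultimately show "\<exists>A B. openin Z A \<and> openin (sum_topology X I) B \<and> z \<in> A \<and> y \<in> B \<and>
        A \<times> B \<subseteq> {p \<in> topspace (prod_topology Z (sum_topology X I)). f p \<in> U}"
      using AB(1,3,4) y(1) by blast
  qed
qed

text \<open>
  A homotopy on the realization may be checked one simplex at a time. The product of the quotient map
  above with the identity of \<open>Z\<close> is again a quotient map because \<open>Z\<close> is locally compact.
\<close>

lemma continuous_map_prod_realization:
  assumes Z: "locally_compact_space Z" "Hausdorff_space Z"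
    and f: "\<And>\<sigma>. \<sigma> \<in> K \<Longrightarrow> continuous_map (prod_topology Z (simplex_space \<sigma>)) W f"
  shows "continuous_map (prod_topology Z (realization K)) W f"
proof -
  let ?q = "\<lambda>(z, p). (z, snd p)"
  have "quotient_map (prod_topology Z (sum_topology simplex_space K)) (prod_topology Z (realization K)) ?q"
    using quotient_map_prod_right[OF Z(1) _ quotient_map_simplices_realization] Z(2) by blast
  moreover have "continuous_map (prod_topology Z (sum_topology simplex_space K)) W (f \<circ> ?q)"
    by (rule continuous_map_prod_sum_topology) (use f in \<open>simp add: case_prod_unfold\<close>)
  ultimately show ?thesis
    using continuous_compose_quotient_map by blast
qed

text \<open>
  A finite subcomplex is a finite union of closed simplices, and a set that is closed in the weak
  topology meets each of these in a closed set. Hence a map into a finite subcomplex is continuous as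
  soon as its coordinates are.
\<close>

lemma continuous_map_into_realization:
  assumes f: "continuous_map Z (powertop_real UNIV) f"
    and F: "finite F" "F \<subseteq> K" "f ` topspace Z \<subseteq> (\<Union>\<sigma>\<in>F. closed_simplex \<sigma>)"
    and closed: "\<And>\<sigma>. \<sigma> \<in> F \<Longrightarrow> finite \<sigma>"
  shows "continuous_map Z (realization K) f"
  unfolding continuous_map_closedin
proof (intro conjI allI impI)
  show "f \<in> topspace Z \<rightarrow> topspace (realization K)"
    using F(2,3) by (fastforce simp: realization_points_def)
  have closed_simplex: "closedin (powertop_real UNIV) (closed_simplex \<sigma>)" if "finite \<sigma>" for \<sigma> :: "'b set"
  proof -
    have coord: "continuous_map (powertop_real UNIV) euclideanreal (\<lambda>t::'b \<Rightarrow> real. t v)" for v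
      using continuous_map_product_projection[of v UNIV "\<lambda>_. euclideanreal"] by simp
    have "closedin (powertop_real UNIV) {t. 0 \<le> t v}" for v :: 'b
      using closedin_continuous_map_preimage[OF coord[of v], of "{0..}"] by simp
    moreover have "closedin (powertop_real UNIV) {t. t v = 0}" for v :: 'b
      using closedin_continuous_map_preimage[OF coord[of v], of "{0}"] by simp
    moreover have "closedin (powertop_real UNIV) {t. (\<Sum>v\<in>\<sigma>. t v) = 1}"
      using closedin_continuous_map_preimage[OF continuous_map_sum[OF that coord], of "{1}" "\<lambda>x. x"] by simp
    ultimately have "closedin (powertop_real UNIV)
        (\<Inter> (range (\<lambda>v. {t. 0 \<le> t v}) \<union> (\<lambda>v. {t. t v = 0}) ` (- \<sigma>) \<union> {{t. (\<Sum>v\<in>\<sigma>. t v) = 1}}))"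
      by (intro closedin_Inter) auto
    moreover have "(\<Inter> (range (\<lambda>v. {t. 0 \<le> t v}) \<union> (\<lambda>v. {t. t v = 0}) ` (- \<sigma>) \<union> {{t. (\<Sum>v\<in>\<sigma>. t v) = 1}}))
        = closed_simplex \<sigma>"
      unfolding closed_simplex_def by auto
    ultimately show ?thesis by simp
  qed
  fix C assume C: "closedin (realization K) C"
  have "closedin Z {z \<in> topspace Z. f z \<in> C \<inter> closed_simplex \<sigma>}" if "\<sigma> \<in> F" for \<sigma>
  proof -
    have "openin (realization K) (realization_points K - C)"
      using C by (simp add: closedin_def)
    then have "openin (simplex_space \<sigma>) ((realization_points K - C) \<inter> closed_simplex \<sigma>)"
      using that F(2) unfolding openin_realization by blast
    then have "closedin (simplex_space \<sigma>) (closed_simplex \<sigma> - (realization_points K - C) \<inter> closed_simplex \<sigma>)"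
      by (simp add: closedin_def double_diff)
    moreover have "closed_simplex \<sigma> - (realization_points K - C) \<inter> closed_simplex \<sigma> = C \<inter> closed_simplex \<sigma>"
      using that F(2) by (auto simp: realization_points_def)
    ultimately have "closedin (powertop_real UNIV) (C \<inter> closed_simplex \<sigma>)"
      using closed_simplex[OF closed[OF that]] by (simp add: closedin_trans_full)
    then show ?thesis
      using closedin_continuous_map_preimage[OF f] by blast
  qed
  then have "closedin Z (\<Union>\<sigma>\<in>F. {z \<in> topspace Z. f z \<in> C \<inter> closed_simplex \<sigma>})"
    using F(1) by (intro closedin_Union) auto
  moreover have "(\<Union>\<sigma>\<in>F. {z \<in> topspace Z. f z \<in> C \<inter> closed_simplex \<sigma>}) = {z \<in> topspace Z. f z \<in> C}"
    using F(3) by (auto simp: image_subset_iff)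
  ultimately show "closedin Z {z \<in> topspace Z. f z \<in> C}" by simp
qed

lemma realization_points_order_complex:
  "t \<in> realization_points (order_complex P r) \<longleftrightarrow>
     (\<forall>v. 0 \<le> t v) \<and> finite {v. t v \<noteq> 0} \<and> (\<Sum>v | t v \<noteq> 0. t v) = 1 \<and>
     {v. t v \<noteq> 0} \<subseteq> P \<and> {v. t v \<noteq> 0} \<in> Chains r"
  (is "?L \<longleftrightarrow> ?R")
proof
  assume ?L
  then obtain \<sigma> where \<sigma>: "\<sigma> \<subseteq> P" "finite \<sigma>" "\<sigma> \<in> Chains r" "t \<in> closed_simplex \<sigma>"
    by (auto simp: realization_points_def order_complex_def)
  then have sub: "{v. t v \<noteq> 0} \<subseteq> \<sigma>" by (auto simp: closed_simplex_def)
  then have "(\<Sum>v | t v \<noteq> 0. t v) = (\<Sum>v\<in>\<sigma>. t v)"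
    using \<sigma>(2) by (intro sum.mono_neutral_left) auto
  moreover have "{v. t v \<noteq> 0} \<in> Chains r"
    using sub \<sigma>(3) unfolding Chains_def by blast
  ultimately show ?R
    using \<sigma> sub finite_subset[OF sub] by (auto simp: closed_simplex_def)
next
  assume R: ?R
  then have "{v. t v \<noteq> 0} \<noteq> {}" by (metis sum.empty zero_neq_one)
  then have "{v. t v \<noteq> 0} \<in> order_complex P r" using R by (simp add: order_complex_def)
  moreover have "t \<in> closed_simplex {v. t v \<noteq> 0}" using R by (simp add: closed_simplex_def)
  ultimately show ?L unfolding realization_points_def by blast
qed

section \<open>Monotone upper bounds in directed preorders\<close>

lemma directed_finite_upper_bound:
  assumes trans: "trans r"
    and directed: "\<And>x y. x \<in> P \<Longrightarrow> y \<in> P \<Longrightarrow> \<exists>z\<in>P. (x, z) \<in> r \<and> (y, z) \<in> r"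
    and "finite A" "A \<subseteq> P" "P \<noteq> {}"
  shows "\<exists>z\<in>P. \<forall>x\<in>A. (x, z) \<in> r"
  using assms(3,4)
proof (induction A rule: finite_induct)
  case empty
  then show ?case using \<open>P \<noteq> {}\<close> by blast
next
  case (insert a A)
  then obtain z where z: "z \<in> P" "\<forall>x\<in>A. (x, z) \<in> r" by auto
  obtain w where "w \<in> P" "(a, w) \<in> r" "(z, w) \<in> r"
    using directed[of a z] insert.prems z(1) by auto
  then show ?case using z(2) transD[OF trans] by blast
qed

text \<open>
  By recursion along strict inclusion of finite sets: \<open>u A\<close> is chosen above \<open>b\<close>, above the members of
  \<open>A\<close>, and above the finitely many \<open>u B\<close> with \<open>B \<subset> A\<close>.
\<close>

lemma directed_monotone_upper_bounds:
  assumes trans: "trans r" and refl: "\<And>x. x \<in> P \<Longrightarrow> (x, x) \<in> r"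
    and directed: "\<And>x y. x \<in> P \<Longrightarrow> y \<in> P \<Longrightarrow> \<exists>z\<in>P. (x, z) \<in> r \<and> (y, z) \<in> r"
    and b: "b \<in> P"
  obtains u where
    "\<And>A. finite A \<Longrightarrow> A \<subseteq> P \<Longrightarrow> u A \<in> P \<and> (b, u A) \<in> r \<and> (\<forall>a\<in>A. (a, u A) \<in> r)"
    "\<And>A B. finite B \<Longrightarrow> B \<subseteq> P \<Longrightarrow> A \<subseteq> B \<Longrightarrow> (u A, u B) \<in> r"
proof -
  let ?Q = "\<lambda>f A z. finite A \<and> A \<subseteq> P \<longrightarrow>
    z \<in> P \<and> (b, z) \<in> r \<and> (\<forall>a\<in>A. (a, z) \<in> r) \<and> (\<forall>B. B \<subset> A \<longrightarrow> (f B, z) \<in> r)"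
  have "\<exists>u. \<forall>A. ?Q u A (u A)"
  proof (rule dependent_wf_choice[OF wf_finite_psubset])
    fix f g :: "'a set \<Rightarrow> 'a" and A z
    assume eq: "\<And>B. (B, A) \<in> finite_psubset \<Longrightarrow> f B = g B"
    show "?Q f A z = ?Q g A z"
    proof (cases "finite A")
      case True
      then have "\<And>B. B \<subset> A \<Longrightarrow> f B = g B"
        using eq by (simp add: finite_psubset_def)
      then show ?thesis by auto
    qed simp
  next
    fix A and f :: "'a set \<Rightarrow> 'a"
    assume IH: "\<And>B. (B, A) \<in> finite_psubset \<Longrightarrow> ?Q f B (f B)"
    show "\<exists>z. ?Q f A z"
    proof (cases "finite A \<and> A \<subseteq> P")
      case True
      have "f B \<in> P" if "B \<subset> A" for B
        using IH[of B] that True finite_subset[of B A] by (auto simp: finite_psubset_def)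
      moreover have "finite {B. B \<subset> A}"
        by (rule finite_subset[of _ "Pow A"]) (use True in auto)
      ultimately have "\<exists>z\<in>P. \<forall>x\<in>insert b (A \<union> f ` {B. B \<subset> A}). (x, z) \<in> r"
        using True b by (intro directed_finite_upper_bound[OF trans]) (auto simp: directed)
      then show ?thesis by auto
    qed auto
  qed
  then obtain u where u: "\<And>A. ?Q u A (u A)" by blast
  show thesis
  proof (rule that)
    show bound: "u A \<in> P \<and> (b, u A) \<in> r \<and> (\<forall>a\<in>A. (a, u A) \<in> r)" if "finite A" "A \<subseteq> P" for A
      using u[of A] that by blast
    show "(u A, u B) \<in> r" if "finite B" "B \<subseteq> P" "A \<subseteq> B" for A B
    proof (cases "A = B")
      case True
      then show ?thesis using bound[OF that(1,2)] refl by blast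
    next
      case False
      then show ?thesis using u[of B] that by blast
    qed
  qed
qed

section \<open>Lengths of superlevel sets\<close>

definition superlevel :: "('v \<Rightarrow> real) \<Rightarrow> real \<Rightarrow> 'v set" where
  "superlevel x c = {v. c \<le> x v}"

text \<open>
  The length of the set of levels up to \<open>s\<close> at which the superlevel set of \<open>x\<close> is exactly \<open>\<rho>\<close>. Up to the
  factor \<open>card \<rho>\<close>, this is the barycentric coordinate of \<open>x\<close> at the barycentre of \<open>\<rho>\<close> in the barycentric
  subdivision when \<open>s \<ge> 1\<close>.
\<close>

definition level_length :: "real \<Rightarrow> ('v \<Rightarrow> real) \<Rightarrow> 'v set \<Rightarrow> real" where
  "level_length s x \<rho> = measure lborel {c. 0 < c \<and> c \<le> s \<and> superlevel x c = \<rho>}"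

lemma superlevel_subset_simplex:
  "x \<in> closed_simplex \<tau> \<Longrightarrow> 0 < c \<Longrightarrow> superlevel x c \<subseteq> \<tau>"
  by (force simp: closed_simplex_def superlevel_def)

text \<open>
  A positive level \<open>c\<close> has superlevel set \<open>\<rho>\<close> iff \<open>x\<close> is at least \<open>c\<close> on \<open>\<rho>\<close> and below \<open>c\<close> on the rest of
  the simplex. The 0 under \<open>Max\<close> encodes \<open>0 < c\<close>, and it keeps \<open>Max\<close> meaningful when \<open>\<rho> = \<tau>\<close>.
\<close>

lemma levels_interval:
  assumes x: "x \<in> closed_simplex \<tau>" and \<rho>: "finite \<tau>" "\<rho> \<subseteq> \<tau>" "\<rho> \<noteq> {}"
  shows "{c. 0 < c \<and> c \<le> s \<and> superlevel x c = \<rho>} =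
    {Max (insert 0 (x ` (\<tau> - \<rho>)))<..min s (Min (x ` \<rho>))}"
proof -
  have fin: "finite \<rho>" using \<rho> finite_subset by blast
  have "superlevel x c = \<rho> \<longleftrightarrow> (\<forall>v\<in>\<rho>. c \<le> x v) \<and> (\<forall>v\<in>\<tau> - \<rho>. x v < c)" if "0 < c" for c
  proof
    assume "superlevel x c = \<rho>"
    then show "(\<forall>v\<in>\<rho>. c \<le> x v) \<and> (\<forall>v\<in>\<tau> - \<rho>. x v < c)"
      by (auto simp: superlevel_def)
  next
    assume R: "(\<forall>v\<in>\<rho>. c \<le> x v) \<and> (\<forall>v\<in>\<tau> - \<rho>. x v < c)"
    show "superlevel x c = \<rho>"
    proof (rule Set.set_eqI)
      fix v
      have "v \<in> \<tau>" if "c \<le> x v"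
        using superlevel_subset_simplex[OF x \<open>0 < c\<close>] that unfolding superlevel_def by blast
      moreover have "\<not> c \<le> x v" if "v \<in> \<tau>" "v \<notin> \<rho>"
        using R that by (meson DiffI not_le)
      ultimately show "v \<in> superlevel x c \<longleftrightarrow> v \<in> \<rho>"
        using R unfolding superlevel_def by blast
    qed
  qed
  then have "c \<in> {c. 0 < c \<and> c \<le> s \<and> superlevel x c = \<rho>} \<longleftrightarrow>
      c \<in> {Max (insert 0 (x ` (\<tau> - \<rho>)))<..min s (Min (x ` \<rho>))}" for c
    using fin \<rho> by (cases "0 < c") auto
  then show ?thesis by blast
qed

lemma level_length_eq:
  assumes "x \<in> closed_simplex \<tau>" "finite \<tau>" "\<rho> \<subseteq> \<tau>" "\<rho> \<noteq> {}"
  shows "level_length s x \<rho> = max 0 (min s (Min (x ` \<rho>)) - Max (insert 0 (x ` (\<tau> - \<rho>))))"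
proof -
  have "measure lborel {a<..b} = max 0 (b - a)" for a b :: real
    by (cases "a \<le> b") auto
  then show ?thesis
    unfolding level_length_def levels_interval[OF assms] by simp
qed

lemma level_length_nonneg: "0 \<le> level_length s x \<rho>"
  by (simp add: level_length_def)

lemma level_length_nonzeroD:
  assumes "level_length s x \<rho> \<noteq> 0"
  obtains c where "0 < c" "c \<le> s" "superlevel x c = \<rho>"
proof -
  have "{c. 0 < c \<and> c \<le> s \<and> superlevel x c = \<rho>} \<noteq> {}"
    using assms by (auto simp: level_length_def simp del: Collect_empty_eq)
  then show thesis using that by blast
qed

text \<open>
  The levels whose superlevel set contains \<open>v\<close> are those up to \<open>x v\<close>; sorting them by superlevel set
  partitions the interval \<open>(0, min s (x v)]\<close>.
\<close>

lemma sum_level_length_containing: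
  assumes x: "x \<in> closed_simplex \<tau>" and "finite \<tau>" "v \<in> \<tau>" "0 \<le> s"
  shows "(\<Sum>\<rho> | \<rho> \<subseteq> \<tau> \<and> v \<in> \<rho>. level_length s x \<rho>) = min s (x v)"
proof -
  let ?L = "\<lambda>\<rho>. {c. 0 < c \<and> c \<le> s \<and> superlevel x c = \<rho>}"
  have L: "?L \<rho> = {Max (insert 0 (x ` (\<tau> - \<rho>)))<..min s (Min (x ` \<rho>))}" if "\<rho> \<subseteq> \<tau>" "v \<in> \<rho>" for \<rho>
    using levels_interval[OF x assms(2) that(1)] that(2) by blast
  have "(\<Sum>\<rho> | \<rho> \<subseteq> \<tau> \<and> v \<in> \<rho>. level_length s x \<rho>) = measure lborel (\<Union>\<rho>\<in>{\<rho>. \<rho> \<subseteq> \<tau> \<and> v \<in> \<rho>}. ?L \<rho>)"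
    unfolding level_length_def
  proof (rule measure_finite_Union[symmetric])
    show "finite {\<rho>. \<rho> \<subseteq> \<tau> \<and> v \<in> \<rho>}" using assms(2) by auto
    show "?L ` {\<rho>. \<rho> \<subseteq> \<tau> \<and> v \<in> \<rho>} \<subseteq> sets lborel"
    proof (rule image_subsetI)
      fix \<rho> assume "\<rho> \<in> {\<rho>. \<rho> \<subseteq> \<tau> \<and> v \<in> \<rho>}"
      then have "?L \<rho> = {Max (insert 0 (x ` (\<tau> - \<rho>)))<..min s (Min (x ` \<rho>))}"
        using L by blast
      then show "?L \<rho> \<in> sets lborel" by simp
    qed
    show "disjoint_family_on ?L {\<rho>. \<rho> \<subseteq> \<tau> \<and> v \<in> \<rho>}" by (auto simp: disjoint_family_on_def)
    show "emeasure lborel (?L \<rho>) \<noteq> \<infinity>" if "\<rho> \<in> {\<rho>. \<rho> \<subseteq> \<tau> \<and> v \<in> \<rho>}" for \<rho>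
    proof -
      have "?L \<rho> \<subseteq> {0..s}" by auto
      then have "emeasure lborel (?L \<rho>) \<le> emeasure lborel {0..s}"
        by (intro emeasure_mono) auto
      then show ?thesis using assms(4) by (auto simp: top_unique)
    qed
  qed
  also have "(\<Union>\<rho>\<in>{\<rho>. \<rho> \<subseteq> \<tau> \<and> v \<in> \<rho>}. ?L \<rho>) = {0<..min s (x v)}"
  proof (rule Set.set_eqI)
    fix c
    have "c \<in> (\<Union>\<rho>\<in>{\<rho>. \<rho> \<subseteq> \<tau> \<and> v \<in> \<rho>}. ?L \<rho>) \<longleftrightarrow>
        0 < c \<and> c \<le> s \<and> superlevel x c \<subseteq> \<tau> \<and> v \<in> superlevel x c"
      by blast
    also have "\<dots> \<longleftrightarrow> 0 < c \<and> c \<le> s \<and> c \<le> x v"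
      using superlevel_subset_simplex[OF x] unfolding superlevel_def by blast
    finally show "c \<in> (\<Union>\<rho>\<in>{\<rho>. \<rho> \<subseteq> \<tau> \<and> v \<in> \<rho>}. ?L \<rho>) \<longleftrightarrow> c \<in> {0<..min s (x v)}"
      by simp
  qed
  also have "measure lborel {0<..min s (x v)} = min s (x v)"
    using x assms(4) by (simp add: closed_simplex_def)
  finally show ?thesis .
qed

section \<open>The flow towards upper bounds\<close>

text \<open>
  The point reached from \<open>x\<close> at time \<open>s\<close>: what exceeds the level \<open>s\<close> has not moved yet, and below this
  level the mass of each superlevel set \<open>\<rho>\<close> (its number of vertices times its length) sits at \<open>u \<rho>\<close>.
  Only subsets of the support of \<open>x\<close> occur as superlevel sets, which makes the sum finite.
\<close>

definition flow :: "('v set \<Rightarrow> 'v) \<Rightarrow> real \<Rightarrow> ('v \<Rightarrow> real) \<Rightarrow> 'v \<Rightarrow> real" where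
  "flow u s x p = max (x p - s) 0 +
     (\<Sum>\<rho> | \<rho> \<subseteq> {v. x v \<noteq> 0} \<and> \<rho> \<noteq> {} \<and> u \<rho> = p. real (card \<rho>) * level_length s x \<rho>)"

text \<open>
  On a fixed simplex the sum may be taken over all non-empty faces, whatever the support of the point;
  in this form the coordinates are visibly continuous.
\<close>

lemma flow_eq:
  assumes x: "x \<in> closed_simplex \<tau>" and \<tau>: "finite \<tau>"
  shows "flow u s x p = max (x p - s) 0 +
    (\<Sum>\<rho>\<in>Pow \<tau> - {{}}. if u \<rho> = p then real (card \<rho>) * level_length s x \<rho> else 0)"
proof -
  have "level_length s x \<rho> = 0" if "\<not> \<rho> \<subseteq> {v. x v \<noteq> 0}" for \<rho>
  proof (rule ccontr)
    assume "level_length s x \<rho> \<noteq> 0"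
    then obtain c where "0 < c" "superlevel x c = \<rho>" by (rule level_length_nonzeroD)
    then have "\<rho> \<subseteq> {v. x v \<noteq> 0}" by (auto simp: superlevel_def)
    with that show False by blast
  qed
  moreover have "{v. x v \<noteq> 0} \<subseteq> \<tau>" using x by (auto simp: closed_simplex_def)
  ultimately have "(\<Sum>\<rho> | \<rho> \<subseteq> {v. x v \<noteq> 0} \<and> \<rho> \<noteq> {} \<and> u \<rho> = p. real (card \<rho>) * level_length s x \<rho>) =
      (\<Sum>\<rho> | \<rho> \<in> Pow \<tau> - {{}} \<and> u \<rho> = p. real (card \<rho>) * level_length s x \<rho>)"
    using \<tau> by (intro sum.mono_neutral_left) auto
  also have "\<dots> = (\<Sum>\<rho>\<in>Pow \<tau> - {{}}. if u \<rho> = p then real (card \<rho>) * level_length s x \<rho> else 0)"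
    using \<tau> by (intro sum.inter_filter) simp
  finally show ?thesis by (simp add: flow_def)
qed

lemma flow_0: "(\<And>v. 0 \<le> x v) \<Longrightarrow> flow u 0 x = x"
proof -
  assume "\<And>v. 0 \<le> x v"
  moreover have "level_length 0 x \<rho> = 0" for \<rho>
    by (rule ccontr, erule level_length_nonzeroD) simp
  ultimately show ?thesis by (simp add: flow_def fun_eq_iff)
qed

lemma flow_nonneg: "0 \<le> flow u s x p"
  unfolding flow_def by (intro add_nonneg_nonneg sum_nonneg mult_nonneg_nonneg level_length_nonneg) auto

lemma flow_nonzeroD:
  assumes "flow u s x p \<noteq> 0"
  shows "s < x p \<or> (\<exists>c. 0 < c \<and> c \<le> s \<and> superlevel x c \<noteq> {} \<and> p = u (superlevel x c))"
proof (cases "s < x p")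
  case False
  then have "(\<Sum>\<rho> | \<rho> \<subseteq> {v. x v \<noteq> 0} \<and> \<rho> \<noteq> {} \<and> u \<rho> = p. real (card \<rho>) * level_length s x \<rho>) \<noteq> 0"
    using assms by (simp add: flow_def)
  then obtain \<rho> where "\<rho> \<noteq> {}" "u \<rho> = p" "real (card \<rho>) * level_length s x \<rho> \<noteq> 0"
    by (rule sum.not_neutral_contains_not_neutral) auto
  then show ?thesis
    using level_length_nonzeroD[of s x \<rho>] by (metis mult_zero_right)
qed simp

text \<open>
  No mass is lost. Counting the moved mass vertex by vertex, \<open>v\<close> contributes the length of the levels
  up to \<open>s\<close> whose superlevel set contains it, which is \<open>min s (x v)\<close>; together with the unmoved part
  \<open>max (x v - s) 0\<close> this is \<open>x v\<close>.
\<close>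

lemma sum_flow:
  assumes x: "x \<in> closed_simplex \<tau>" and \<tau>: "finite \<tau>" and s: "0 \<le> s"
    and V: "finite V" "\<tau> \<subseteq> V" "u ` Pow \<tau> \<subseteq> V"
  shows "(\<Sum>p\<in>V. flow u s x p) = 1"
proof -
  let ?L = "level_length s x"
  have "(\<Sum>p\<in>V. max (x p - s) 0) = (\<Sum>p\<in>\<tau>. max (x p - s) 0)"
    using V s x by (intro sum.mono_neutral_right) (auto simp: closed_simplex_def)
  moreover have "(\<Sum>p\<in>V. \<Sum>\<rho>\<in>Pow \<tau> - {{}}. if u \<rho> = p then real (card \<rho>) * ?L \<rho> else 0) =
      (\<Sum>v\<in>\<tau>. min s (x v))"
  proof -
    have "(\<Sum>p\<in>V. \<Sum>\<rho>\<in>Pow \<tau> - {{}}. if u \<rho> = p then real (card \<rho>) * ?L \<rho> else 0) =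
        (\<Sum>\<rho>\<in>Pow \<tau> - {{}}. \<Sum>p\<in>V. if u \<rho> = p then real (card \<rho>) * ?L \<rho> else 0)"
      by (rule sum.swap)
    also have "\<dots> = (\<Sum>\<rho>\<in>Pow \<tau> - {{}}. real (card \<rho>) * ?L \<rho>)"
    proof (rule sum.cong[OF refl])
      fix \<rho> assume "\<rho> \<in> Pow \<tau> - {{}}"
      then have "u \<rho> \<in> V" using V(3) by blast
      then show "(\<Sum>p\<in>V. if u \<rho> = p then real (card \<rho>) * ?L \<rho> else 0) = real (card \<rho>) * ?L \<rho>"
        using V(1) by simp
    qed
    also have "\<dots> = (\<Sum>\<rho>\<in>Pow \<tau>. real (card \<rho>) * ?L \<rho>)"
      using \<tau> by (intro sum.mono_neutral_left) auto
    also have "\<dots> = (\<Sum>\<rho>\<in>Pow \<tau>. \<Sum>v\<in>\<tau>. if v \<in> \<rho> then ?L \<rho> else 0)"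
    proof (rule sum.cong[OF refl])
      fix \<rho> assume "\<rho> \<in> Pow \<tau>"
      then have "{v \<in> \<tau>. v \<in> \<rho>} = \<rho>" by blast
      then show "real (card \<rho>) * ?L \<rho> = (\<Sum>v\<in>\<tau>. if v \<in> \<rho> then ?L \<rho> else 0)"
        using sum.inter_filter[OF \<tau>, of "\<lambda>_. ?L \<rho>" "\<lambda>v. v \<in> \<rho>"] by simp
    qed
    also have "\<dots> = (\<Sum>v\<in>\<tau>. \<Sum>\<rho>\<in>Pow \<tau>. if v \<in> \<rho> then ?L \<rho> else 0)"
      by (rule sum.swap)
    also have "\<dots> = (\<Sum>v\<in>\<tau>. min s (x v))"
    proof (rule sum.cong[OF refl])
      fix v assume v: "v \<in> \<tau>"
      have "(\<Sum>\<rho>\<in>Pow \<tau>. if v \<in> \<rho> then ?L \<rho> else 0) = (\<Sum>\<rho> | \<rho> \<in> Pow \<tau> \<and> v \<in> \<rho>. ?L \<rho>)"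
        using \<tau> by (intro sum.inter_filter[symmetric]) simp
      then show "(\<Sum>\<rho>\<in>Pow \<tau>. if v \<in> \<rho> then ?L \<rho> else 0) = min s (x v)"
        using sum_level_length_containing[OF x \<tau> v s] by simp
    qed
    finally show ?thesis .
  qed
  ultimately have "(\<Sum>p\<in>V. flow u s x p) = (\<Sum>v\<in>\<tau>. max (x v - s) 0) + (\<Sum>v\<in>\<tau>. min s (x v))"
    by (simp add: flow_eq[OF x \<tau>] sum.distrib)
  also have "\<dots> = (\<Sum>v\<in>\<tau>. x v)"
    unfolding sum.distrib[symmetric] by (intro sum.cong) auto
  also have "\<dots> = 1" using x by (simp add: closed_simplex_def)
  finally show ?thesis .
qed

lemma continuous_map_Min:
  assumes "finite A" "A \<noteq> {}" "\<And>v. v \<in> A \<Longrightarrow> continuous_map T euclideanreal (\<lambda>z. f z v)"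
  shows "continuous_map T euclideanreal (\<lambda>z. Min (f z ` A))"
  using assms by (induction A rule: finite_ne_induct) (simp_all add: continuous_map_real_min)

lemma continuous_map_Max:
  assumes "finite A" "A \<noteq> {}" "\<And>v. v \<in> A \<Longrightarrow> continuous_map T euclideanreal (\<lambda>z. f z v)"
  shows "continuous_map T euclideanreal (\<lambda>z. Max (f z ` A))"
  using assms by (induction A rule: finite_ne_induct) (simp_all add: continuous_map_real_max)

lemma continuous_map_flow:
  assumes \<tau>: "finite \<tau>"
  shows "continuous_map (prod_topology (top_of_set I) (simplex_space \<tau>)) euclideanreal
           (\<lambda>z. flow u (fst z) (snd z) p)"
proof -
  let ?T = "prod_topology (top_of_set I) (simplex_space \<tau>)"
  have s: "continuous_map ?T euclideanreal fst"
    using continuous_map_fst continuous_map_into_fulltopology by blast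
  have x: "continuous_map ?T euclideanreal (\<lambda>z. snd z v)" for v
  proof -
    have "continuous_map ?T (powertop_real UNIV) snd"
      using continuous_map_snd continuous_map_into_fulltopology by blast
    then show ?thesis by (simp add: continuous_map_componentwise_UNIV)
  qed
  have Max: "continuous_map ?T euclideanreal (\<lambda>z. Max (insert 0 (snd z ` (\<tau> - \<rho>))))" for \<rho>
  proof (cases "\<tau> - \<rho> = {}")
    case False
    then have "continuous_map ?T euclideanreal (\<lambda>z. max 0 (Max (snd z ` (\<tau> - \<rho>))))"
      using \<tau> by (intro continuous_map_real_max continuous_map_Max x) auto
    then show ?thesis
      using False \<tau> by (subst Max_insert) auto
  next
    case True
    then show ?thesis by (simp only: image_empty) simp
  qed
  have L: "continuous_map ?T euclideanreal
      (\<lambda>z. max 0 (min (fst z) (Min (snd z ` \<rho>)) - Max (insert 0 (snd z ` (\<tau> - \<rho>)))))"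
    if "\<rho> \<in> Pow \<tau> - {{}}" for \<rho>
  proof -
    have "finite \<rho>" "\<rho> \<noteq> {}" using that \<tau> finite_subset by auto
    then show ?thesis
      by (intro continuous_map_real_max continuous_map_real_min continuous_map_diff
          continuous_map_Min Max s x) auto
  qed
  have "continuous_map ?T euclideanreal (\<lambda>z. max (snd z p - fst z) 0 +
      (\<Sum>\<rho>\<in>Pow \<tau> - {{}}. if u \<rho> = p then real (card \<rho>) *
        max 0 (min (fst z) (Min (snd z ` \<rho>)) - Max (insert 0 (snd z ` (\<tau> - \<rho>)))) else 0))"
  proof (intro continuous_map_add continuous_map_real_max continuous_map_diff s x continuous_map_sum)
    fix \<rho> assume "\<rho> \<in> Pow \<tau> - {{}}"
    then show "continuous_map ?T euclideanreal (\<lambda>z. if u \<rho> = p then real (card \<rho>) *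
        max 0 (min (fst z) (Min (snd z ` \<rho>)) - Max (insert 0 (snd z ` (\<tau> - \<rho>)))) else 0)"
      using L[of \<rho>] by (cases "u \<rho> = p") (simp_all add: continuous_map_real_mult_left)
  qed (use \<tau> in auto)
  then show ?thesis
  proof (rule continuous_map_eq)
    fix z assume "z \<in> topspace ?T"
    then have z: "snd z \<in> closed_simplex \<tau>" by auto
    show "max (snd z p - fst z) 0 +
      (\<Sum>\<rho>\<in>Pow \<tau> - {{}}. if u \<rho> = p then real (card \<rho>) *
        max 0 (min (fst z) (Min (snd z ` \<rho>)) - Max (insert 0 (snd z ` (\<tau> - \<rho>)))) else 0) =
      flow u (fst z) (snd z) p"
      unfolding flow_eq[OF z \<tau>] using level_length_eq[OF z \<tau>]
      by (intro arg_cong2[where f = "(+)"] refl sum.cong) auto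
  qed
qed

section \<open>Contractibility of directed preorders\<close>

lemma abstract_complex_order_complex:
  assumes refl: "\<And>x. x \<in> P \<Longrightarrow> (x, x) \<in> r"
  shows "abstract_complex P (order_complex P r)"
  unfolding abstract_complex_def
proof (intro conjI ballI allI impI)
  fix \<sigma> \<tau> assume "\<sigma> \<in> order_complex P r" "\<tau> \<subseteq> \<sigma>" "\<tau> \<noteq> {}"
  then show "\<tau> \<in> order_complex P r"
    unfolding order_complex_def Chains_def by (simp add: finite_subset subset_iff)
qed (use refl in \<open>auto simp: order_complex_def Chains_def\<close>)

text \<open>
  The support of a point is a simplex that contains it, so a finite set bounding the supports over one
  simplex confines the homotopy there to a finite subcomplex.
\<close>

lemma homotopic_order_complexI:
  fixes h :: "real \<Rightarrow> ('v \<Rightarrow> real) \<Rightarrow> 'v \<Rightarrow> real"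
  assumes K: "K = order_complex P r"
    and cont: "\<And>\<tau> p. \<tau> \<in> K \<Longrightarrow>
      continuous_map (prod_topology (top_of_set {0..1}) (simplex_space \<tau>)) euclideanreal
        (\<lambda>z. h (fst z) (snd z) p)"
    and points: "\<And>s x. s \<in> {0..1} \<Longrightarrow> x \<in> realization_points K \<Longrightarrow> h s x \<in> realization_points K"
    and support: "\<And>\<tau>. \<tau> \<in> K \<Longrightarrow>
      \<exists>V. finite V \<and> (\<forall>s\<in>{0..1}. \<forall>x\<in>closed_simplex \<tau>. {v. h s x v \<noteq> 0} \<subseteq> V)"
    and ends: "\<And>x. x \<in> realization_points K \<Longrightarrow> h 0 x = f x"
       "\<And>x. x \<in> realization_points K \<Longrightarrow> h 1 x = g x"
  shows "homotopic_with (\<lambda>_. True) (realization K) (realization K) f g"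
proof -
  let ?h = "\<lambda>z. h (fst z) (snd z)"
  have "continuous_map (prod_topology (top_of_set {0..1}) (realization K)) (realization K) ?h"
  proof (rule continuous_map_prod_realization)
    show "locally_compact_space (top_of_set {0..1::real})"
      by (intro compact_imp_locally_compact_space) (simp add: compact_space_subtopology)
    show "Hausdorff_space (top_of_set {0..1::real})"
      by (simp add: Hausdorff_space_subtopology)
    fix \<tau> assume \<tau>: "\<tau> \<in> K"
    obtain V where V: "finite V" "\<And>s x. s \<in> {0..1} \<Longrightarrow> x \<in> closed_simplex \<tau> \<Longrightarrow> {v. h s x v \<noteq> 0} \<subseteq> V"
      using support[OF \<tau>] by blast
    let ?F = "{\<sigma> \<in> K. \<sigma> \<subseteq> V}"
    show "continuous_map (prod_topology (top_of_set {0..1}) (simplex_space \<tau>)) (realization K) ?h"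
    proof (rule continuous_map_into_realization[of _ _ ?F])
      show "continuous_map (prod_topology (top_of_set {0..1}) (simplex_space \<tau>)) (powertop_real UNIV) ?h"
        using cont[OF \<tau>] by (simp add: continuous_map_componentwise_UNIV)
      show "finite ?F" using V(1) by simp
      show "finite \<sigma>" if "\<sigma> \<in> ?F" for \<sigma> using that by (simp add: K order_complex_def)
      show "?h ` topspace (prod_topology (top_of_set {0..1}) (simplex_space \<tau>)) \<subseteq> (\<Union>\<sigma>\<in>?F. closed_simplex \<sigma>)"
      proof (rule image_subsetI)
        fix z assume "z \<in> topspace (prod_topology (top_of_set {0..1::real}) (simplex_space \<tau>))"
        then have z: "fst z \<in> {0..1}" "snd z \<in> closed_simplex \<tau>" by auto
        let ?\<sigma> = "{v. h (fst z) (snd z) v \<noteq> 0}"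
        have "snd z \<in> realization_points K" using z(2) \<tau> by (auto simp: realization_points_def)
        then have *: "?h z \<in> realization_points K" by (rule points[OF z(1)])
        then have "?\<sigma> \<noteq> {}"
          unfolding K realization_points_order_complex by (metis sum.empty zero_neq_one)
        then have "?\<sigma> \<in> ?F" "?h z \<in> closed_simplex ?\<sigma>"
          using * V(2)[OF z] unfolding K realization_points_order_complex
          by (auto simp: order_complex_def closed_simplex_def)
        then show "?h z \<in> (\<Union>\<sigma>\<in>?F. closed_simplex \<sigma>)" by blast
      qed
    qed blast
  qed
  then show ?thesis
    using ends by (intro homotopic_with[THEN iffD2]) (auto intro!: exI[of _ ?h])
qed

text \<open>
  The flow is a homotopy from the identity to \<open>flow u 1\<close>. The latter only uses vertices above the base
  point \<open>b\<close>, since coordinates never exceed 1, so adding \<open>b\<close> to its support still gives a chain and the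
  straight line to \<open>b\<close> stays in the complex.
\<close>

lemma contractible_order_complex_directed:
  assumes trans: "trans r" and refl: "\<And>x. x \<in> P \<Longrightarrow> (x, x) \<in> r"
    and directed: "\<And>x y. x \<in> P \<Longrightarrow> y \<in> P \<Longrightarrow> \<exists>z\<in>P. (x, z) \<in> r \<and> (y, z) \<in> r"
    and "P \<noteq> {}"
  shows "contractible_complex (order_complex P r)"
proof -
  let ?K = "order_complex P r"
  obtain b where b: "b \<in> P" using \<open>P \<noteq> {}\<close> by blast
  obtain u where bound: "\<And>A. finite A \<Longrightarrow> A \<subseteq> P \<Longrightarrow> u A \<in> P \<and> (b, u A) \<in> r \<and> (\<forall>a\<in>A. (a, u A) \<in> r)"
    and mono: "\<And>A B. finite B \<Longrightarrow> B \<subseteq> P \<Longrightarrow> A \<subseteq> B \<Longrightarrow> (u A, u B) \<in> r"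
    using directed_monotone_upper_bounds[OF trans refl directed b] by blast
  define \<beta> where "\<beta> = (\<lambda>p. if p = b then 1 else 0 :: real)"
  define H where "H = (\<lambda>t x p. (1 - t) * flow u 1 x p + t * \<beta> p)"
  have simplex: "finite \<tau> \<and> \<tau> \<subseteq> P" if "\<tau> \<in> ?K" for \<tau>
    using that by (simp add: order_complex_def)
  have levels: "finite (superlevel x c) \<and> superlevel x c \<subseteq> P \<and> superlevel x c \<in> Chains r"
    if "x \<in> realization_points ?K" "0 < c" for x c
  proof -
    have sub: "superlevel x c \<subseteq> {v. x v \<noteq> 0}" using that(2) by (auto simp: superlevel_def)
    have "finite {v. x v \<noteq> 0}" "{v. x v \<noteq> 0} \<subseteq> P" "{v. x v \<noteq> 0} \<in> Chains r"
      using that(1) unfolding realization_points_order_complex by auto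
    then show ?thesis
      using sub finite_subset[OF sub] unfolding Chains_def by blast
  qed
  have flow_support: "{p. flow u s x p \<noteq> 0} \<subseteq> \<tau> \<union> u ` Pow \<tau>"
    if "x \<in> closed_simplex \<tau>" "0 \<le> s" for s x \<tau>
  proof
    fix p assume "p \<in> {p. flow u s x p \<noteq> 0}"
    then consider "s < x p" | c where "0 < c" "p = u (superlevel x c)"
      using flow_nonzeroD[of u s x p] by blast
    then show "p \<in> \<tau> \<union> u ` Pow \<tau>"
    proof cases
      case 1
      then show ?thesis using that by (auto simp: closed_simplex_def)
    next
      case 2
      then show ?thesis using superlevel_subset_simplex[OF that(1)] by blast
    qed
  qed
  have nonneg: "0 \<le> x v" if "x \<in> realization_points ?K" for x v
    using that unfolding realization_points_order_complex by blast
  have le_1: "x v \<le> 1" if x: "x \<in> realization_points ?K" for x v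
  proof (cases "x v = 0")
    case False
    have "finite {v. x v \<noteq> 0}" "(\<Sum>v | x v \<noteq> 0. x v) = 1"
      using x unfolding realization_points_order_complex by auto
    then show ?thesis
      using member_le_sum[of v "{v. x v \<noteq> 0}" x] False nonneg[OF x] by simp
  qed simp
  \<comment> \<open>The key point: at every time the vertices in use form a chain.\<close>
  have comparable: "(p, q) \<in> r \<or> (q, p) \<in> r"
    if x: "x \<in> realization_points ?K" and s: "0 \<le> s"
      and pq: "flow u s x p \<noteq> 0" "flow u s x q \<noteq> 0" for s x p q
  proof -
    \<comment> \<open>Superlevel sets shrink as the level grows, and \<open>u\<close> is monotone.\<close>
    have uu: "(u (superlevel x c), u (superlevel x d)) \<in> r" if "0 < d" "d \<le> c" for c d
      using levels[OF x that(1)] that(2) by (intro mono) (auto simp: superlevel_def)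
    \<comment> \<open>A vertex that has not started to move belongs to all superlevel sets that have been moved.\<close>
    have xu: "(v, u (superlevel x c)) \<in> r" if "0 < c" "c \<le> s" "s < x v" for v c
    proof -
      have "v \<in> superlevel x c" using that by (simp add: superlevel_def)
      then show ?thesis using bound levels[OF x that(1)] by blast
    qed
    have xx: "(v, w) \<in> r \<or> (w, v) \<in> r" if "s < x v" "s < x w" for v w
    proof -
      have "{v. x v \<noteq> 0} \<in> Chains r" using x unfolding realization_points_order_complex by blast
      then show ?thesis using that s unfolding Chains_def by force
    qed
    from flow_nonzeroD[OF pq(1)] flow_nonzeroD[OF pq(2)] show ?thesis
      using uu xu xx by (metis linear)
  qed
  have flow_point: "flow u s x \<in> realization_points ?K"
    if x: "x \<in> realization_points ?K" and s: "0 \<le> s" for s x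
  proof -
    obtain \<tau> where \<tau>: "\<tau> \<in> ?K" "x \<in> closed_simplex \<tau>"
      using x by (auto simp: realization_points_def)
    let ?V = "\<tau> \<union> u ` Pow \<tau>"
    have V: "finite ?V" using simplex[OF \<tau>(1)] by simp
    have sub: "{p. flow u s x p \<noteq> 0} \<subseteq> ?V" by (rule flow_support[OF \<tau>(2) s])
    have "?V \<subseteq> P"
    proof -
      have "u \<rho> \<in> P" if "\<rho> \<subseteq> \<tau>" for \<rho>
        using bound[of \<rho>] simplex[OF \<tau>(1)] that finite_subset by blast
      then show ?thesis using simplex[OF \<tau>(1)] by blast
    qed
    moreover have "(\<Sum>p | flow u s x p \<noteq> 0. flow u s x p) = (\<Sum>p\<in>?V. flow u s x p)"
      using V sub by (intro sum.mono_neutral_left) auto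
    moreover have "(\<Sum>p\<in>?V. flow u s x p) = 1"
      using simplex[OF \<tau>(1)] V by (intro sum_flow[OF \<tau>(2) _ s]) auto
    moreover have "{p. flow u s x p \<noteq> 0} \<in> Chains r"
      using comparable[OF x s] by (simp add: Chains_def)
    ultimately show ?thesis
      unfolding realization_points_order_complex
      using flow_nonneg[of u s x] finite_subset[OF sub V] subset_trans[OF sub] by simp
  qed
  have H_point: "H t x \<in> realization_points ?K"
    if x: "x \<in> realization_points ?K" and t: "t \<in> {0..1}" for t x
  proof -
    let ?f = "flow u 1 x" and ?V = "insert b {p. flow u 1 x p \<noteq> 0}"
    have f: "finite {p. ?f p \<noteq> 0}" "(\<Sum>p | ?f p \<noteq> 0. ?f p) = 1" "{p. ?f p \<noteq> 0} \<subseteq> P"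
      using flow_point[OF x, of 1] unfolding realization_points_order_complex by auto
    have "(\<Sum>p\<in>?V. ?f p) = (\<Sum>p | ?f p \<noteq> 0. ?f p)"
      using f(1) by (intro sum.mono_neutral_right) auto
    then have "(\<Sum>p\<in>?V. H t x p) = 1"
      using f(1,2) by (simp only: H_def sum.distrib sum_distrib_left[symmetric] \<beta>_def) simp
    moreover have sub: "{p. H t x p \<noteq> 0} \<subseteq> ?V" by (auto simp: H_def \<beta>_def)
    then have "(\<Sum>p | H t x p \<noteq> 0. H t x p) = (\<Sum>p\<in>?V. H t x p)"
      using f(1) by (intro sum.mono_neutral_left) auto
    moreover have "0 \<le> H t x p" for p
      using t flow_nonneg[of u 1 x p] by (auto simp: H_def \<beta>_def)
    moreover have "{p. H t x p \<noteq> 0} \<in> Chains r"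
    proof -
      have "(b, p) \<in> r" if "?f p \<noteq> 0" for p
        using flow_nonzeroD[OF that] le_1[OF x, of p] levels[OF x] bound by fastforce
      then have "(p, q) \<in> r \<or> (q, p) \<in> r" if "p \<in> ?V" "q \<in> ?V" for p q
        using that comparable[OF x, of 1 p q] refl[OF b] by auto
      then show ?thesis using sub unfolding Chains_def by blast
    qed
    moreover have "{p. H t x p \<noteq> 0} \<subseteq> P" using sub f(3) b by blast
    ultimately show ?thesis
      unfolding realization_points_order_complex using f(1) finite_subset[OF sub] by auto
  qed
  have "homotopic_with (\<lambda>_. True) (realization ?K) (realization ?K) id (flow u 1)"
  proof (rule homotopic_order_complexI[where h = "flow u"])
    show "?K = ?K" ..
    fix \<tau> p assume \<tau>: "\<tau> \<in> ?K"
    show "continuous_map (prod_topology (top_of_set {0..1}) (simplex_space \<tau>)) euclideanreal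
        (\<lambda>z. flow u (fst z) (snd z) p)"
      using simplex[OF \<tau>] by (intro continuous_map_flow) blast
    show "\<exists>V. finite V \<and> (\<forall>s\<in>{0..1}. \<forall>x\<in>closed_simplex \<tau>. {p. flow u s x p \<noteq> 0} \<subseteq> V)"
      using simplex[OF \<tau>] flow_support by (intro exI[of _ "\<tau> \<union> u ` Pow \<tau>"]) auto
  next
    show "flow u s x \<in> realization_points ?K" if "s \<in> {0..1}" "x \<in> realization_points ?K" for s x
      using flow_point that by simp
    show "flow u 0 x = id x" if "x \<in> realization_points ?K" for x
      using flow_0 nonneg[OF that] by fastforce
  qed blast
  moreover have "homotopic_with (\<lambda>_. True) (realization ?K) (realization ?K) (flow u 1) (\<lambda>_. \<beta>)"
  proof (rule homotopic_order_complexI[where h = H])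
    show "?K = ?K" ..
    fix \<tau> p assume \<tau>: "\<tau> \<in> ?K"
    let ?T = "prod_topology (top_of_set {0..1::real}) (simplex_space \<tau>)"
    have t: "continuous_map ?T euclideanreal fst"
      using continuous_map_fst continuous_map_into_fulltopology by blast
    have "continuous_map ?T (prod_topology (top_of_set {1}) (simplex_space \<tau>)) (\<lambda>z. (1, snd z))"
      by (simp add: continuous_map_paired continuous_map_snd)
    then have "continuous_map ?T euclideanreal ((\<lambda>z. flow u (fst z) (snd z) p) \<circ> (\<lambda>z. (1, snd z)))"
      using simplex[OF \<tau>] by (intro continuous_map_compose[OF _ continuous_map_flow]) auto
    then have "continuous_map ?T euclideanreal (\<lambda>z. flow u 1 (snd z) p)"
      by (simp add: o_def)
    then show "continuous_map ?T euclideanreal (\<lambda>z. H (fst z) (snd z) p)"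
      unfolding H_def
      by (intro continuous_map_add continuous_map_real_mult continuous_map_diff t) auto
    show "\<exists>V. finite V \<and> (\<forall>s\<in>{0..1}. \<forall>x\<in>closed_simplex \<tau>. {p. H s x p \<noteq> 0} \<subseteq> V)"
    proof (intro exI[of _ "insert b (\<tau> \<union> u ` Pow \<tau>)"] conjI ballI)
      show "finite (insert b (\<tau> \<union> u ` Pow \<tau>))" using simplex[OF \<tau>] by simp
      fix s x assume "x \<in> closed_simplex \<tau>"
      then have "{p. flow u 1 x p \<noteq> 0} \<subseteq> \<tau> \<union> u ` Pow \<tau>" by (rule flow_support) simp
      moreover have "{p. H s x p \<noteq> 0} \<subseteq> insert b {p. flow u 1 x p \<noteq> 0}" by (auto simp: H_def \<beta>_def)
      ultimately show "{p. H s x p \<noteq> 0} \<subseteq> insert b (\<tau> \<union> u ` Pow \<tau>)" by blast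
    qed
  qed (simp_all add: H_point, simp_all add: H_def fun_eq_iff)
  ultimately have "homotopic_with (\<lambda>_. True) (realization ?K) (realization ?K) id (\<lambda>_. \<beta>)"
    by (rule homotopic_with_trans)
  moreover have "\<beta> \<in> realization_points ?K"
    unfolding realization_points_order_complex using b refl[OF b] by (auto simp: \<beta>_def Chains_def)
  ultimately show ?thesis
    unfolding contractible_complex_def contractible_space_def by auto
qed

section \<open>Partial bijections\<close>

lemma restr_eq: "restr f E = Id_on E O f"
  by (auto simp: restr_def)

lemma Domain_restr [simp]: "Domain (restr f E) = Domain f \<inter> E"
  by (auto simp: restr_def)

lemma Range_restr: "Range (restr f E) = f `` E"
  by (auto simp: restr_def)

lemma restr_restr: "restr (restr f E) F = restr f (E \<inter> F)"
  by (auto simp: restr_def)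

lemma restr_relcomp: "restr f E O g = restr (f O g) E"
  by (auto simp: restr_def)

lemma restr_Domain: "Domain f \<subseteq> E \<Longrightarrow> restr f E = f"
  by (auto simp: restr_def)

lemma Id_on_relcomp: "Domain f \<subseteq> D \<Longrightarrow> Id_on D O f = f"
  by auto

lemma relcomp_Id_on: "Range f \<subseteq> D \<Longrightarrow> f O Id_on D = f"
  by auto

lemma Domain_relcomp_eq: "Range f \<subseteq> Domain g \<Longrightarrow> Domain (f O g) = Domain f"
  by blast

lemma Range_relcomp_eq: "Domain g \<subseteq> Range f \<Longrightarrow> Range (f O g) = Range g"
  by blast

lemma partial_bij_relcomp_converse: "partial_bij X f \<Longrightarrow> f O f\<inverse> = Id_on (Domain f)"
  unfolding partial_bij_def single_valued_def by blast

lemma partial_bij_converse: "partial_bij X f \<Longrightarrow> partial_bij X (f\<inverse>)"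
  unfolding partial_bij_def by auto

lemma partial_bij_converse_relcomp: "partial_bij X f \<Longrightarrow> f\<inverse> O f = Id_on (Range f)"
  using partial_bij_relcomp_converse[OF partial_bij_converse, of X f] by simp

lemma partial_bij_comp: "partial_bij X f \<Longrightarrow> partial_bij X g \<Longrightarrow> partial_bij X (f O g)"
  unfolding partial_bij_def by (auto simp: converse_relcomp intro!: single_valued_relcomp)

lemma partial_bij_Image_disjoint:
  "partial_bij X f \<Longrightarrow> A \<inter> B = {} \<Longrightarrow> f `` A \<inter> f `` B = {}"
  unfolding partial_bij_def single_valued_def by blast

context partial_bijection_system
begin

lemma Id_on_Domain: "s \<in> S \<Longrightarrow> Id_on (Domain s) \<in> S"
  using partial_bij_relcomp_converse[OF partial_bij] comp_closed inverse_closed by metis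

lemma domainsD: "D \<in> domains S \<Longrightarrow> Id_on D \<in> S"
  unfolding domains_def using Id_on_Domain by blast

lemma Domain_in_domains: "s \<in> S \<Longrightarrow> Domain s \<in> domains S"
  unfolding domains_def by blast

lemma Range_in_domains: "s \<in> S \<Longrightarrow> Range s \<in> domains S"
  using Domain_in_domains[OF inverse_closed] by simp

lemma domains_subset: "D \<in> domains S \<Longrightarrow> D \<subseteq> X"
  using partial_bij unfolding domains_def partial_bij_def by blast

lemma domains_Int: "D \<in> domains S \<Longrightarrow> E \<in> domains S \<Longrightarrow> D \<inter> E \<in> domains S"
proof -
  assume "D \<in> domains S" "E \<in> domains S"
  then have "Id_on D O Id_on E \<in> S" using domainsD comp_closed by blast
  then have "Domain (Id_on D O Id_on E) \<in> domains S" by (rule Domain_in_domains)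
  moreover have "Domain (Id_on D O Id_on E) = D \<inter> E" by auto
  ultimately show ?thesis by simp
qed

text \<open>
  With sets of pieces in place of indexed families; injectivity makes the images of the pieces disjoint.
\<close>

lemma in_hat_iff:
  "f \<in> hat X S \<longleftrightarrow> partial_bij X f \<and>
     (\<exists>\<D>. finite \<D> \<and> partition_on (Domain f) \<D> \<and> (\<forall>D\<in>\<D>. restr f D \<in> S))"
  (is "?L \<longleftrightarrow> ?R")
proof
  assume ?L
  then obtain m :: nat and D E where f: "partial_bij X f" and D: "disjoint_family_on D {1..m}"
    "Domain f = (\<Union>i\<in>{1..m}. D i)"
    and DE: "\<forall>i\<in>{1..m}. restr f (D i) \<in> S \<and> Range (restr f (D i)) = E i"
    unfolding hat_def mem_Collect_eq by (elim exE conjE) (rule that)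
  have "partition_on (Domain f) (D ` {1..m} - {{}})"
    using D(2) disjoint_family_on_disjoint_image[OF D(1)]
    by (auto simp: partition_on_def disjoint_def)
  moreover have "\<forall>D\<in>D ` {1..m} - {{}}. restr f D \<in> S" using DE by blast
  ultimately show ?R using f by (intro conjI exI[of _ "D ` {1..m} - {{}}"]) auto
next
  assume ?R
  then obtain \<D> where f: "partial_bij X f" and \<D>: "finite \<D>" "partition_on (Domain f) \<D>"
    "\<And>D. D \<in> \<D> \<Longrightarrow> restr f D \<in> S" by blast
  obtain D where "bij_betw D {1..card \<D>} \<D>"
    using ex_bij_betw_nat_finite_1[OF \<D>(1)] by blast
  then have inj: "inj_on D {1..card \<D>}" and img: "D ` {1..card \<D>} = \<D>"
    by (simp_all add: bij_betw_def)
  have disj: "disjoint_family_on D {1..card \<D>}"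
    using \<D>(2) inj img unfolding partition_on_def disjoint_def disjoint_family_on_def inj_on_def
    by (metis image_eqI)
  have dom: "Domain f = (\<Union>i\<in>{1..card \<D>}. D i)"
    using partition_onD1[OF \<D>(2)] by (simp only: img)
  have "disjoint_family_on (\<lambda>i. f `` D i) {1..card \<D>}"
    using disj partial_bij_Image_disjoint[OF f] unfolding disjoint_family_on_def by blast
  moreover have "Range f = (\<Union>i\<in>{1..card \<D>}. f `` D i)"
    using dom by blast
  moreover have "\<forall>i\<in>{1..card \<D>}. restr f (D i) \<in> S" using img \<D>(3) by blast
  moreover have "\<forall>i\<in>{1..card \<D>}. Range (restr f (D i)) = f `` D i" by (simp add: Range_restr)
  ultimately have "disjoint_family_on D {1..card \<D>} \<and> Domain f = (\<Union>i\<in>{1..card \<D>}. D i) \<and>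
      disjoint_family_on (\<lambda>i. f `` D i) {1..card \<D>} \<and> Range f = (\<Union>i\<in>{1..card \<D>}. f `` D i) \<and>
      (\<forall>i\<in>{1..card \<D>}. restr f (D i) \<in> S \<and> Range (restr f (D i)) = f `` D i)"
    using disj dom by (intro conjI ballI) simp_all
  then show ?L
    unfolding hat_def mem_Collect_eq
    by (intro conjI[OF f] exI[of _ "card \<D>"] exI[of _ D] exI[of _ "\<lambda>i. f `` D i"])
qed

lemma hat_partial_bij: "f \<in> hat X S \<Longrightarrow> partial_bij X f"
  by (simp add: in_hat_iff)

text \<open>
  Empty pieces are dropped, as blocks of a partition are non-empty.
\<close>

lemma finite_disjoint_union_of_domainsD:
  assumes "finite_disjoint_union_of_domains S Y"
  obtains \<Q> where "finite \<Q>" "partition_on Y \<Q>" "\<Q> \<subseteq> ne_domains S"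
proof -
  obtain m :: nat and D where D: "disjoint_family_on D {1..m}"
    "\<forall>i\<in>{1..m}. D i \<in> domains S" "Y = (\<Union>i\<in>{1..m}. D i)"
    using assms unfolding finite_disjoint_union_of_domains_def by blast
  have "partition_on Y (D ` {1..m} - {{}})"
    using D(3) disjoint_family_on_disjoint_image[OF D(1)]
    by (auto simp: partition_on_def disjoint_def)
  moreover have "D ` {1..m} - {{}} \<subseteq> ne_domains S"
    using D(2) by (auto simp: ne_domains_def)
  ultimately show thesis using that[of "D ` {1..m} - {{}}"] by simp
qed

lemma S_subset_hat: "s \<in> S \<Longrightarrow> s \<in> hat X S"
  unfolding in_hat_iff
  by (intro conjI exI[of _ "{Domain s} - {{}}"] partial_bij)
    (auto simp: partition_on_def disjoint_def restr_Domain)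

lemma Id_on_X_in_hat: "Id_on X \<in> hat X S"
proof -
  obtain \<Q> where \<Q>: "finite \<Q>" "partition_on X \<Q>" "\<Q> \<subseteq> ne_domains S"
    using finite_disjoint_union_of_domainsD[OF X_union_of_domains] .
  have "restr (Id_on X) D \<in> S" if "D \<in> \<Q>" for D
  proof -
    have D: "D \<in> domains S" using that \<Q>(3) by (auto simp: ne_domains_def)
    then have "restr (Id_on X) D = Id_on D" using domains_subset[OF D] by (auto simp: restr_def)
    then show ?thesis using domainsD[OF D] by simp
  qed
  then show ?thesis
    unfolding in_hat_iff using \<Q>(1,2)
    by (intro conjI exI[of _ \<Q>]) (auto simp: partial_bij_def single_valued_def)
qed

lemma hat_converse: "f \<in> hat X S \<Longrightarrow> f\<inverse> \<in> hat X S"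
proof -
  assume "f \<in> hat X S"
  then obtain \<D> where f: "partial_bij X f" and \<D>: "finite \<D>" "partition_on (Domain f) \<D>"
    "\<And>D. D \<in> \<D> \<Longrightarrow> restr f D \<in> S" unfolding in_hat_iff by blast
  let ?E = "(\<lambda>D. f `` D) ` \<D>"
  have "partition_on (Domain (f\<inverse>)) ?E"
    unfolding partition_on_def
  proof (intro conjI)
    show "\<Union>?E = Domain (f\<inverse>)"
      using partition_onD1[OF \<D>(2)] by blast
    show "disjoint ?E"
    proof (rule disjointI)
      fix A B assume "A \<in> ?E" "B \<in> ?E" "A \<noteq> B"
      then obtain D D' where D: "D \<in> \<D>" "A = f `` D" "D' \<in> \<D>" "B = f `` D'" "D \<noteq> D'" by blast
      then have "D \<inter> D' = {}" using \<D>(2) unfolding partition_on_def disjoint_def by blast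
      then show "A \<inter> B = {}" using D partial_bij_Image_disjoint[OF f] by blast
    qed
    show "{} \<notin> ?E"
    proof
      assume "{} \<in> ?E"
      then obtain D where "D \<in> \<D>" "f `` D = {}" by blast
      moreover have "D \<subseteq> Domain f" "D \<noteq> {}" using \<D>(2) \<open>D \<in> \<D>\<close> unfolding partition_on_def by auto
      ultimately show False by blast
    qed
  qed
  moreover have "restr (f\<inverse>) E \<in> S" if E: "E \<in> ?E" for E
  proof -
    obtain D where D: "D \<in> \<D>" "E = f `` D" using E by blast
    have "restr (f\<inverse>) E = (restr f D)\<inverse>"
      using f unfolding D(2) restr_def partial_bij_def single_valued_def by blast
    then show ?thesis using \<D>(3)[OF D(1)] inverse_closed by simp
  qed
  ultimately show ?thesis
    unfolding in_hat_iff using \<D>(1) partial_bij_converse[OF f] by blast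
qed

text \<open>
  The composite of a piece of \<open>f\<close> with a piece of \<open>g\<close> is in \<open>S\<close>; the domains of these composites are the
  pieces of \<open>f O g\<close>.
\<close>

lemma hat_comp: "f \<in> hat X S \<Longrightarrow> g \<in> hat X S \<Longrightarrow> f O g \<in> hat X S"
proof -
  assume "f \<in> hat X S" "g \<in> hat X S"
  then obtain \<D> \<E> where f: "partial_bij X f" and \<D>: "finite \<D>" "partition_on (Domain f) \<D>"
      "\<And>D. D \<in> \<D> \<Longrightarrow> restr f D \<in> S"
    and g: "partial_bij X g" and \<E>: "finite \<E>" "partition_on (Domain g) \<E>"
      "\<And>E. E \<in> \<E> \<Longrightarrow> restr g E \<in> S"
    unfolding in_hat_iff by blast
  let ?A = "\<lambda>D E. Domain (restr f D O restr g E)"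
  let ?F = "{?A D E | D E. D \<in> \<D> \<and> E \<in> \<E>} - {{}}"
  have A: "x \<in> ?A D E \<longleftrightarrow> x \<in> D \<and> (\<exists>y z. (x, y) \<in> f \<and> y \<in> E \<and> (y, z) \<in> g)" for x D E
    by (auto simp: restr_def)
  have "partition_on (Domain (f O g)) ?F"
    unfolding partition_on_def
  proof (intro conjI)
    have cover: "\<exists>D\<in>\<D>. \<exists>E\<in>\<E>. x \<in> ?A D E" if x: "x \<in> Domain (f O g)" for x
    proof -
      obtain y z where yz: "(x, y) \<in> f" "(y, z) \<in> g" using x by blast
      then have "x \<in> Domain f" "y \<in> Domain g" by blast+
      then have "x \<in> \<Union>\<D>" "y \<in> \<Union>\<E>"
        using partition_onD1[OF \<D>(2)] partition_onD1[OF \<E>(2)] by simp_all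
      then show ?thesis unfolding A using yz by blast
    qed
    show "\<Union>?F = Domain (f O g)"
    proof (rule subset_antisym; rule subsetI)
      fix x assume "x \<in> \<Union>?F"
      then obtain D E where "x \<in> ?A D E" by auto
      then show "x \<in> Domain (f O g)" unfolding A by blast
    next
      fix x assume "x \<in> Domain (f O g)"
      then obtain D E where "D \<in> \<D>" "E \<in> \<E>" "x \<in> ?A D E" using cover by blast
      moreover from this have "?A D E \<in> ?F" by blast
      ultimately show "x \<in> \<Union>?F" by (intro UnionI)
    qed
    show "disjoint ?F"
    proof (rule disjointI)
      fix U V assume "U \<in> ?F" "V \<in> ?F" "U \<noteq> V"
      then obtain D E D' E' where U: "D \<in> \<D>" "E \<in> \<E>" "U = ?A D E"
        and V: "D' \<in> \<D>" "E' \<in> \<E>" "V = ?A D' E'" by auto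
      show "U \<inter> V = {}"
      proof (rule ccontr)
        assume "U \<inter> V \<noteq> {}"
        then obtain x where "x \<in> ?A D E" "x \<in> ?A D' E'" using U(3) V(3) by blast
        then obtain y y' where "x \<in> D" "x \<in> D'" "(x, y) \<in> f" "(x, y') \<in> f" "y \<in> E" "y' \<in> E'"
          unfolding A by blast
        moreover from this have "y = y'" using f unfolding partial_bij_def single_valued_def by blast
        ultimately have "D = D'" "E = E'"
          using U V \<D>(2) \<E>(2) unfolding partition_on_def disjoint_def by blast+
        then show False using \<open>U \<noteq> V\<close> U(3) V(3) by blast
      qed
    qed
  qed blast
  moreover have "restr (f O g) U \<in> S" if U: "U \<in> ?F" for U
  proof -
    obtain D E where DE: "D \<in> \<D>" "E \<in> \<E>" "U = ?A D E" using U by auto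
    have "restr (f O g) (?A D E) = restr f D O restr g E"
    proof (rule subset_antisym; rule subrelI)
      fix x z
      assume "(x, z) \<in> restr (f O g) (?A D E)"
      then obtain y y' where "x \<in> D" "(x, y) \<in> f" "(y, z) \<in> g" "(x, y') \<in> f" "y' \<in> E"
        unfolding restr_def by blast
      moreover from this have "y = y'"
        using f unfolding partial_bij_def single_valued_def by blast
      ultimately show "(x, z) \<in> restr f D O restr g E" unfolding restr_def by blast
    next
      fix x z
      assume "(x, z) \<in> restr f D O restr g E"
      then show "(x, z) \<in> restr (f O g) (?A D E)" unfolding restr_def by blast
    qed
    then show ?thesis using DE \<D>(3) \<E>(3) comp_closed by metis
  qed
  moreover have "finite ?F"
  proof -
    have "?F \<subseteq> (\<lambda>(D, E). ?A D E) ` (\<D> \<times> \<E>)" by auto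
    moreover have "finite ((\<lambda>(D, E). ?A D E) ` (\<D> \<times> \<E>))" using \<D>(1) \<E>(1) by simp
    ultimately show ?thesis by (rule finite_subset)
  qed
  ultimately show ?thesis
    unfolding in_hat_iff using partial_bij_comp[OF f g] by blast
qed

lemma ld_pairs_iff: "(f, D) \<in> ld_pairs X S \<longleftrightarrow> D \<in> ne_domains S \<and> Domain f = D \<and> f \<in> hat X S"
  by (simp add: ld_pairs_def locally_determined_def)

lemma ne_domainsD: "D \<in> ne_domains S \<Longrightarrow> D \<in> domains S \<and> D \<noteq> {} \<and> D \<subseteq> X"
  using domains_subset by (auto simp: ne_domains_def)

lemma ld_pairs_restr:
  assumes f: "(f, D) \<in> ld_pairs X S" and E: "E \<in> ne_domains S" "E \<subseteq> D"
  shows "(restr f E, E) \<in> ld_pairs X S"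
proof -
  have "Id_on E O f \<in> hat X S"
    using f ne_domainsD[OF E(1)] hat_comp[OF S_subset_hat[OF domainsD]] by (simp add: ld_pairs_iff)
  moreover have "Domain (restr f E) = E" using f E(2) by (auto simp: ld_pairs_iff)
  ultimately show ?thesis using E(1) by (simp add: ld_pairs_iff restr_eq)
qed

lemma ld_pairs_Id_on: "E \<in> ne_domains S \<Longrightarrow> (Id_on E, E) \<in> ld_pairs X S"
  using S_subset_hat[OF domainsD] ne_domainsD unfolding ld_pairs_iff by simp

lemma ld_pairs_precomp:
  assumes "(f, D) \<in> ld_pairs X S" "h \<in> S" "Domain h = D'" "Range h = D" "D' \<in> ne_domains S"
  shows "(h O f, D') \<in> ld_pairs X S"
  using assms hat_comp[OF S_subset_hat] unfolding ld_pairs_iff by (simp add: Domain_relcomp_eq)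

lemma carrier_GammaS:
  "\<gamma> \<in> carrier (GammaS X S) \<longleftrightarrow> \<gamma> \<in> hat X S \<and> Domain \<gamma> = X \<and> Range \<gamma> = X"
  by (simp add: GammaS_def)

lemma GammaS_group: "group (GammaS X S)"
proof (rule groupI)
  show "\<one>\<^bsub>GammaS X S\<^esub> \<in> carrier (GammaS X S)"
    using Id_on_X_in_hat by (simp add: GammaS_def)
next
  fix \<gamma> \<delta> assume "\<gamma> \<in> carrier (GammaS X S)" "\<delta> \<in> carrier (GammaS X S)"
  then show "\<gamma> \<otimes>\<^bsub>GammaS X S\<^esub> \<delta> \<in> carrier (GammaS X S)"
    using hat_comp[of \<delta> \<gamma>] by (simp add: GammaS_def Domain_relcomp_eq Range_relcomp_eq)
next
  fix \<gamma> \<delta> \<epsilon>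
  show "\<gamma> \<otimes>\<^bsub>GammaS X S\<^esub> \<delta> \<otimes>\<^bsub>GammaS X S\<^esub> \<epsilon> = \<gamma> \<otimes>\<^bsub>GammaS X S\<^esub> (\<delta> \<otimes>\<^bsub>GammaS X S\<^esub> \<epsilon>)"
    by (simp add: GammaS_def O_assoc)
next
  fix \<gamma> assume "\<gamma> \<in> carrier (GammaS X S)"
  then show "\<one>\<^bsub>GammaS X S\<^esub> \<otimes>\<^bsub>GammaS X S\<^esub> \<gamma> = \<gamma>"
    using relcomp_Id_on[of \<gamma> X] by (simp add: GammaS_def)
next
  fix \<gamma> assume "\<gamma> \<in> carrier (GammaS X S)"
  then have \<gamma>: "\<gamma> \<in> hat X S" "Domain \<gamma> = X" "Range \<gamma> = X" by (simp_all add: carrier_GammaS)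
  show "\<exists>\<delta>\<in>carrier (GammaS X S). \<delta> \<otimes>\<^bsub>GammaS X S\<^esub> \<gamma> = \<one>\<^bsub>GammaS X S\<^esub>"
  proof (rule bexI[of _ "\<gamma>\<inverse>"])
    show "\<gamma>\<inverse> \<in> carrier (GammaS X S)" using \<gamma> hat_converse by (simp add: carrier_GammaS)
    show "\<gamma>\<inverse> \<otimes>\<^bsub>GammaS X S\<^esub> \<gamma> = \<one>\<^bsub>GammaS X S\<^esub>"
      using partial_bij_relcomp_converse[OF hat_partial_bij[OF \<gamma>(1)]] \<gamma>(2) by (simp add: GammaS_def)
  qed
qed

end

section \<open>Refinements of classes\<close>

context S_structure
begin

abbreviation "cl \<equiv> cls X S SS"
abbreviation "std E \<equiv> cls X S SS (Id_on E) E"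
abbreviation "ne \<equiv> ne_domains S"
abbreviation "\<B> \<equiv> pair_classes X S SS"
abbreviation "pv \<equiv> pseudovertex X S SS"
abbreviation "exp_le \<equiv> expansion_le X S SS PP"

lemma SS_D:
  assumes "D \<in> ne" "E \<in> ne" "h \<in> SS D E"
  shows "h \<in> S" "Domain h = D" "Range h = E" "h\<inverse> \<in> SS E D" "h\<inverse> O h = Id_on E"
proof -
  show h: "h \<in> S" using assms SS_subset by blast
  show "Domain h = D" "Range h = E" using S1[OF assms] by auto
  show "h\<inverse> \<in> SS E D" using S3[OF assms] .
  show "h\<inverse> O h = Id_on E"
    using partial_bij_converse_relcomp[OF partial_bij[OF h]] S1[OF assms] by simp
qed

lemma pair_relI:
  "(f, D) \<in> ld_pairs X S \<Longrightarrow> (g, E) \<in> ld_pairs X S \<Longrightarrow> h \<in> SS D E \<Longrightarrow> f = h O g \<Longrightarrow>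
     ((f, D), (g, E)) \<in> pair_rel X S SS"
  by (auto simp: pair_rel_def)

lemma equiv_pair_rel: "equiv (ld_pairs X S) (pair_rel X S SS)"
proof (rule equivI)
  show "pair_rel X S SS \<subseteq> ld_pairs X S \<times> ld_pairs X S"
    by (auto simp: pair_rel_def)
  show "refl_on (ld_pairs X S) (pair_rel X S SS)"
  proof (rule refl_onI)
    fix p assume "p \<in> ld_pairs X S"
    moreover obtain f D where p: "p = (f, D)" by fastforce
    ultimately have ld: "(f, D) \<in> ld_pairs X S" by simp
    have "f = Id_on D O f" using ld by (simp add: ld_pairs_iff Id_on_relcomp)
    then show "(p, p) \<in> pair_rel X S SS"
      unfolding p using ld S2 by (intro pair_relI[of f D f D "Id_on D"]) (auto simp: ld_pairs_iff)
  qed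
  show "sym (pair_rel X S SS)"
  proof (rule symI)
    fix p q assume "(p, q) \<in> pair_rel X S SS"
    then obtain f D g E h where p: "p = (f, D)" "q = (g, E)" and ld: "(f, D) \<in> ld_pairs X S"
      "(g, E) \<in> ld_pairs X S" and h: "h \<in> SS D E" "f = h O g"
      by (auto simp: pair_rel_def)
    have ne: "D \<in> ne" "E \<in> ne" using ld by (simp_all add: ld_pairs_iff)
    have "h\<inverse> O f = Id_on E O g"
      using SS_D(5)[OF ne h(1)] unfolding h(2) by (metis O_assoc)
    then have "g = h\<inverse> O f" using ld(2) by (simp add: ld_pairs_iff Id_on_relcomp)
    then show "(q, p) \<in> pair_rel X S SS"
      unfolding p using ld SS_D(4)[OF ne h(1)] by (intro pair_relI)
  qed
  show "trans (pair_rel X S SS)"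
  proof (rule transI)
    fix p q t assume "(p, q) \<in> pair_rel X S SS" "(q, t) \<in> pair_rel X S SS"
    then obtain f D g E k F h h' where p: "p = (f, D)" "q = (g, E)" "t = (k, F)"
      and ld: "(f, D) \<in> ld_pairs X S" "(g, E) \<in> ld_pairs X S" "(k, F) \<in> ld_pairs X S"
      and h: "h \<in> SS D E" "f = h O g" "h' \<in> SS E F" "g = h' O k"
      by (auto simp: pair_rel_def)
    have "h O h' \<in> SS D F"
      using ld h by (intro S4[of D E F]) (auto simp: ld_pairs_iff)
    then show "(p, t) \<in> pair_rel X S SS"
      unfolding p using ld h by (intro pair_relI) (auto simp: O_assoc)
  qed
qed

lemma cls_eq_Image: "(f, D) \<in> ld_pairs X S \<Longrightarrow> cl f D = pair_rel X S SS `` {(f, D)}"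
  by (simp add: cls_def ld_pairs_iff restr_Domain)

lemma cls_restr: "E \<subseteq> D \<Longrightarrow> cl (restr f D) E = cl f E"
  by (simp add: cls_def restr_restr Int_absorb1)

lemma cls_in_classes: "(f, D) \<in> ld_pairs X S \<Longrightarrow> cl f D \<in> \<B>"
  unfolding pair_classes_def cls_eq_Image by (rule quotientI)

lemma classesE:
  assumes "b \<in> \<B>"
  obtains f D where "(f, D) \<in> ld_pairs X S" "b = cl f D"
proof -
  obtain p where "p \<in> ld_pairs X S" "b = pair_rel X S SS `` {p}"
    using assms unfolding pair_classes_def by (rule quotientE)
  then show thesis using that cls_eq_Image by (cases p) simp
qed

lemma cls_eqI:
  "(f, D) \<in> ld_pairs X S \<Longrightarrow> (g, E) \<in> ld_pairs X S \<Longrightarrow> h \<in> SS D E \<Longrightarrow> f = h O g \<Longrightarrow> cl f D = cl g E"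
  unfolding cls_eq_Image by (intro equiv_class_eq[OF equiv_pair_rel] pair_relI)

lemma mem_cls_iff:
  assumes "(f, D) \<in> ld_pairs X S"
  shows "(g, E) \<in> cl f D \<longleftrightarrow> (g, E) \<in> ld_pairs X S \<and> (\<exists>h\<in>SS E D. g = h O f)"
proof -
  have "(g, E) \<in> cl f D \<longleftrightarrow> ((g, E), (f, D)) \<in> pair_rel X S SS"
    using equiv_pair_rel unfolding cls_eq_Image[OF assms] equiv_def sym_def by blast
  then show ?thesis using assms by (auto simp: pair_rel_def)
qed

lemma mem_cls_self: "(f, D) \<in> ld_pairs X S \<Longrightarrow> (f, D) \<in> cl f D"
  unfolding cls_eq_Image using equiv_pair_rel by (rule equiv_class_self)

lemma class_im_cls:
  assumes f: "(f, D) \<in> ld_pairs X S"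
  shows "class_im (cl f D) = Range f"
proof -
  have "g `` E = Range f" if g: "(g, E) \<in> cl f D" for g E
  proof -
    obtain h where h: "(g, E) \<in> ld_pairs X S" "h \<in> SS E D" "g = h O f"
      using g unfolding mem_cls_iff[OF f] by blast
    have "g `` E = Range (h O f)" using h(1,3) by (auto simp: ld_pairs_iff)
    also have "Range (h O f) = Range f"
      using SS_D(3)[of E D h] f h(1,2) by (intro Range_relcomp_eq) (simp add: ld_pairs_iff)
    finally show ?thesis .
  qed
  then have "(\<lambda>(g, E). g `` E) ` cl f D = (\<lambda>_. Range f) ` cl f D"
  proof (intro image_cong refl)
    fix p assume "p \<in> cl f D"
    then show "(case p of (g, E) \<Rightarrow> g `` E) = Range f"
      using \<open>\<And>g E. (g, E) \<in> cl f D \<Longrightarrow> g `` E = Range f\<close> by (cases p) simp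
  qed
  moreover have "cl f D \<noteq> {}" using mem_cls_self[OF f] by blast
  ultimately show ?thesis unfolding class_im_def by simp
qed

lemma class_im_nonempty: "b \<in> \<B> \<Longrightarrow> class_im b \<noteq> {}"
proof (elim classesE)
  fix f D assume f: "(f, D) \<in> ld_pairs X S" and b: "b = cl f D"
  have "Domain f \<noteq> {}" using f ne_domainsD by (simp add: ld_pairs_iff)
  then show "class_im b \<noteq> {}" unfolding b class_im_cls[OF f] by blast
qed

lemma class_im_std: "E \<in> ne \<Longrightarrow> class_im (std E) = E"
  using class_im_cls[OF ld_pairs_Id_on] by simp

lemma PP_D:
  assumes "D \<in> ne" "\<P> \<in> PP D"
  shows "finite \<P>" "partition_on D \<P>" "\<P> \<subseteq> ne" "\<P> \<noteq> {}"
proof -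
  show *: "finite \<P>" "partition_on D \<P>" using P2[OF assms] by auto
  show "\<P> \<subseteq> ne" using P2[OF assms] partition_onD3[OF *(2)] by (auto simp: ne_domains_def)
  show "\<P> \<noteq> {}" using partition_onD1[OF *(2)] ne_domainsD[OF assms(1)] by auto
qed

text \<open>
  \<open>R\<close> arises from the class \<open>b = [f, D]\<close> by cutting it along a member of \<open>PP D\<close>. In contrast to an
  expansion, the trivial partition \<open>{D}\<close> is admitted and no change of the representative by some
  \<open>h \<in> SS D' D\<close> is performed; since \<open>[fh, D'] = [f, D]\<close>, the latter is no restriction.
\<close>

definition refinement :: "'a pair_class \<Rightarrow> 'a pair_class set \<Rightarrow> bool" where
  "refinement b R \<longleftrightarrow> (\<exists>f D. (f, D) \<in> ld_pairs X S \<and> b = cl f D \<and> (\<exists>\<P>\<in>PP D. R = cl f ` \<P>))"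

lemma cls_piece:
  assumes f: "(f, D) \<in> ld_pairs X S" and E: "E \<in> ne" "E \<subseteq> D"
  shows "cl f E \<in> \<B>" "class_im (cl f E) = f `` E"
proof -
  have eq: "cl f E = cl (restr f E) E" by (simp add: cls_restr)
  show "cl f E \<in> \<B>"
    unfolding eq using ld_pairs_restr[OF f E] by (rule cls_in_classes)
  show "class_im (cl f E) = f `` E"
    unfolding eq class_im_cls[OF ld_pairs_restr[OF f E]] by (rule Range_restr)
qed

lemma refinementD:
  assumes "refinement b R"
  shows "finite R" "R \<subseteq> \<B>" "disjoint_family_on class_im R" "im R = class_im b" "R \<noteq> {}"
proof -
  obtain f D \<P> where f: "(f, D) \<in> ld_pairs X S" "b = cl f D" and \<P>: "\<P> \<in> PP D" "R = cl f ` \<P>"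
    using assms unfolding refinement_def by blast
  have D: "D \<in> ne" "Domain f = D" "partial_bij X f"
    using f(1) hat_partial_bij by (auto simp: ld_pairs_iff)
  note PP = PP_D[OF D(1) \<P>(1)]
  have sub: "E \<in> ne" "E \<subseteq> D" if "E \<in> \<P>" for E
    using PP(2,3) that by (auto simp: partition_on_def)
  note piece = cls_piece[OF f(1) sub]
  show "finite R" "R \<noteq> {}" using PP \<P>(2) by auto
  show "R \<subseteq> \<B>" using piece \<P>(2) by auto
  show "disjoint_family_on class_im R"
    unfolding disjoint_family_on_def \<P>(2)
  proof (clarify)
    fix E F assume EF: "E \<in> \<P>" "F \<in> \<P>" "cl f E \<noteq> cl f F"
    then have "E \<inter> F = {}" using PP(2) unfolding partition_on_def disjoint_def by metis
    then show "class_im (cl f E) \<inter> class_im (cl f F) = {}"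
      using piece(2) EF(1,2) partial_bij_Image_disjoint[OF D(3)] by simp
  qed
  have "im R = (\<Union>E\<in>\<P>. f `` E)" unfolding im_def \<P>(2) using piece(2) by simp
  also have "\<dots> = f `` D" using partition_onD1[OF PP(2)] by blast
  also have "\<dots> = class_im b" unfolding f(2) class_im_cls[OF f(1)] using D(2) by auto
  finally show "im R = class_im b" .
qed

text \<open>
  A refinement along a partition with at least two blocks is an expansion, and one along the trivial
  partition changes nothing.
\<close>

lemma refinement_step:
  assumes v: "pv v" and b: "b \<in> v" and R: "refinement b R"
  shows "pv (v - {b} \<union> R)" "im (v - {b} \<union> R) = im v" "(v, v - {b} \<union> R) \<in> exp_le"
proof -
  note RD = refinementD[OF R]
  have sub: "class_im c \<subseteq> class_im b" if "c \<in> R" for c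
    using RD(4) that by (auto simp: im_def)
  have vD: "finite v" "v \<subseteq> \<B>" "disjoint_family_on class_im v"
    using v by (auto simp: pseudovertex_def)
  have disj: "class_im c \<inter> class_im d = {}" if "c \<in> v - {b}" "d \<in> R" for c d
  proof -
    have "class_im c \<inter> class_im b = {}" using vD(3) b that(1) unfolding disjoint_family_on_def by blast
    then show ?thesis using sub[OF that(2)] by blast
  qed
  have "disjoint_family_on class_im (v - {b} \<union> R)"
    unfolding disjoint_family_on_def
  proof (intro ballI impI)
    fix c d assume "c \<in> v - {b} \<union> R" "d \<in> v - {b} \<union> R" "c \<noteq> d"
    then consider "c \<in> v" "d \<in> v" | "c \<in> R" "d \<in> R" | "c \<in> v - {b}" "d \<in> R" | "d \<in> v - {b}" "c \<in> R"
      by blast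
    then show "class_im c \<inter> class_im d = {}"
      using \<open>c \<noteq> d\<close> vD(3) RD(3) disj unfolding disjoint_family_on_def by cases blast+
  qed
  then show pv: "pv (v - {b} \<union> R)"
    using vD RD unfolding pseudovertex_def by auto
  show "im (v - {b} \<union> R) = im v"
    using RD(4) b unfolding im_def by blast
  obtain f D \<P> where f: "(f, D) \<in> ld_pairs X S" "b = cl f D" and \<P>: "\<P> \<in> PP D" "R = cl f ` \<P>"
    using R unfolding refinement_def by blast
  have D: "D \<in> ne" "Domain f = D" using f(1) by (auto simp: ld_pairs_iff)
  note PP = PP_D[OF D(1) \<P>(1)]
  show "(v, v - {b} \<union> R) \<in> exp_le"
  proof (cases "card \<P> \<ge> 2")
    case True
    have "v - {b} \<union> R = (v - {cl f D}) \<union> {cl (Id_on D O f) E |E. E \<in> \<P>}"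
      using f(2) \<P>(2) D(2) by (auto simp: Id_on_relcomp)
    then have "(v, v - {b} \<union> R) \<in> expansion X S SS PP"
      unfolding expansion_def using v pv f b D(1) S2[OF D(1)] \<P>(1) True by blast
    then show ?thesis unfolding expansion_le_def by blast
  next
    case False
    then have "card \<P> = 1" using PP(1,4) by (metis One_nat_def card_0_eq less_2_cases not_le)
    then obtain E where "\<P> = {E}" by (rule card_1_singletonE)
    then have "\<P> = {D}" using partition_onD1[OF PP(2)] by simp
    then have "v - {b} \<union> R = v" using b f(2) \<P>(2) by auto
    then show ?thesis by (simp add: expansion_le_def)
  qed
qed

lemma exp_le_refl: "(v, v) \<in> exp_le"
  by (simp add: expansion_le_def)

lemma exp_le_trans: "(v, w) \<in> exp_le \<Longrightarrow> (w, z) \<in> exp_le \<Longrightarrow> (v, z) \<in> exp_le"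
  by (simp add: expansion_le_def)

text \<open>
  Refine the members of \<open>v\<close> one after the other. A member \<open>b\<close> that is still to be refined cannot have
  appeared among the pieces of another member \<open>c\<close>: its image is non-empty and disjoint from that of \<open>c\<close>.
\<close>

lemma refine_all:
  assumes v: "pv v" and all: "\<forall>b\<in>v. refinement b (R b)"
  shows "pv (\<Union>b\<in>v. R b)" "im (\<Union>b\<in>v. R b) = im v" "(v, \<Union>b\<in>v. R b) \<in> exp_le"
proof -
  have vD: "finite v" "v \<subseteq> \<B>" "disjoint_family_on class_im v"
    using v by (auto simp: pseudovertex_def)
  have R: "refinement b (R b)" if "b \<in> v" for b using all that by blast
  let ?w = "\<lambda>u. (v - u) \<union> (\<Union>b\<in>u. R b)"
  have "pv (?w u) \<and> im (?w u) = im v \<and> (v, ?w u) \<in> exp_le" if "u \<subseteq> v" for u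
    using finite_subset[OF that vD(1)] that
  proof (induction u rule: finite_induct)
    case empty
    then show ?case using v by (simp add: exp_le_refl)
  next
    case (insert b u)
    then have IH: "pv (?w u)" "im (?w u) = im v" "(v, ?w u) \<in> exp_le" and b: "b \<in> v" by auto
    have "b \<notin> (\<Union>c\<in>u. R c)"
    proof
      assume "b \<in> (\<Union>c\<in>u. R c)"
      then obtain c where c: "c \<in> u" "b \<in> R c" by blast
      then have "c \<in> v" "c \<noteq> b" using insert by auto
      then have "class_im b \<inter> class_im c = {}"
        using vD(3) b unfolding disjoint_family_on_def by blast
      moreover have "class_im b \<subseteq> class_im c"
        using refinementD(4)[OF R[OF \<open>c \<in> v\<close>]] c(2) by (auto simp: im_def)
      ultimately show False using class_im_nonempty vD(2) b by blast
    qed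
    then have "?w (insert b u) = ?w u - {b} \<union> R b" by blast
    moreover have "b \<in> ?w u" using b insert.hyps by blast
    ultimately show ?case
      using refinement_step[OF IH(1) _ R[OF b]] IH(2,3) exp_le_trans by metis
  qed
  from this[of v] show "pv (\<Union>b\<in>v. R b)" "im (\<Union>b\<in>v. R b) = im v" "(v, \<Union>b\<in>v. R b) \<in> exp_le" by auto
qed

section \<open>Directedness of pseudovertices\<close>

text \<open>
  A standard pseudovertex is the same as a finite partition of its image into domains, because
  \<open>[id, E]\<close> has image \<open>E\<close>.
\<close>

lemma std_PV_iff:
  assumes "\<Q> \<subseteq> ne"
  shows "std ` \<Q> \<in> PV X S SS Y \<longleftrightarrow> finite \<Q> \<and> partition_on Y \<Q> \<and> \<Q> \<noteq> {}"
proof -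
  have inj: "inj_on std \<Q>" and ims: "\<And>E. E \<in> \<Q> \<Longrightarrow> class_im (std E) = E"
    using assms class_im_std by (auto intro!: inj_onI) (metis subsetD)+
  have "disjoint_family_on class_im (std ` \<Q>) \<longleftrightarrow>
      (\<forall>E\<in>\<Q>. \<forall>F\<in>\<Q>. std E \<noteq> std F \<longrightarrow> class_im (std E) \<inter> class_im (std F) = {})"
    unfolding disjoint_family_on_def by blast
  also have "\<dots> \<longleftrightarrow> (\<forall>E\<in>\<Q>. \<forall>F\<in>\<Q>. E \<noteq> F \<longrightarrow> E \<inter> F = {})"
  proof (intro ball_cong refl)
    fix E F assume EF: "E \<in> \<Q>" "F \<in> \<Q>"
    have "std E = std F \<longleftrightarrow> E = F" using inj EF by (rule inj_on_eq_iff)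
    then show "(std E \<noteq> std F \<longrightarrow> class_im (std E) \<inter> class_im (std F) = {}) =
        (E \<noteq> F \<longrightarrow> E \<inter> F = {})"
      using ims[OF EF(1)] ims[OF EF(2)] by simp
  qed
  also have "\<dots> \<longleftrightarrow> disjoint \<Q>" unfolding disjoint_def ..
  finally have "disjoint_family_on class_im (std ` \<Q>) \<longleftrightarrow> disjoint \<Q>" .
  moreover have "im (std ` \<Q>) = \<Union>\<Q>" using ims by (auto simp: im_def)
  moreover have "std ` \<Q> \<subseteq> \<B>" using assms cls_in_classes ld_pairs_Id_on by blast
  moreover have "{} \<notin> \<Q>" using assms by (auto simp: ne_domains_def)
  ultimately show ?thesis
    unfolding PV_def pseudovertex_def partition_on_def using inj by (auto simp: finite_image_iff)
qed

lemma std_refinement: "E \<in> ne \<Longrightarrow> \<P> \<in> PP E \<Longrightarrow> refinement (std E) (std ` \<P>)"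
proof -
  assume E: "E \<in> ne" "\<P> \<in> PP E"
  have "cl (Id_on E) F = std F" if "F \<in> \<P>" for F
  proof -
    have "F \<subseteq> E" using partition_onD1[OF PP_D(2)[OF E]] that by blast
    then have "restr (Id_on E) F = restr (Id_on F) F" by (auto simp: restr_def)
    then show ?thesis by (simp add: cls_def)
  qed
  then have "std ` \<P> = cl (Id_on E) ` \<P>" by auto
  then show ?thesis unfolding refinement_def using ld_pairs_Id_on[OF E(1)] E(2) by blast
qed

lemma std_refine_all:
  assumes \<Q>: "finite \<Q>" "partition_on Y \<Q>" "\<Q> \<subseteq> ne" "\<Q> \<noteq> {}"
    and \<P>: "\<forall>E\<in>\<Q>. \<P> E \<in> PP E"
  shows "(std ` \<Q>, std ` (\<Union>E\<in>\<Q>. \<P> E)) \<in> exp_le" "finite (\<Union>E\<in>\<Q>. \<P> E)" "partition_on Y (\<Union>E\<in>\<Q>. \<P> E)"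
    "(\<Union>E\<in>\<Q>. \<P> E) \<subseteq> ne"
proof -
  have PV: "std ` \<Q> \<in> PV X S SS Y" using std_PV_iff \<Q> by blast
  then have pv: "pv (std ` \<Q>)" "im (std ` \<Q>) = Y" by (auto simp: PV_def)
  let ?R = "\<lambda>b. std ` \<P> (class_im b)"
  have "\<forall>b\<in>std ` \<Q>. refinement b (?R b)"
  proof
    fix b assume "b \<in> std ` \<Q>"
    then obtain E where E: "E \<in> \<Q>" "b = std E" by blast
    then have "E \<in> ne" "\<P> E \<in> PP E" using \<Q>(3) \<P> by auto
    then show "refinement b (?R b)" using std_refinement class_im_std E(2) by simp
  qed
  note all = refine_all[OF pv(1) this]
  have eq: "(\<Union>b\<in>std ` \<Q>. ?R b) = std ` (\<Union>E\<in>\<Q>. \<P> E)"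
    using \<Q>(3) class_im_std by (auto simp: subset_iff)
  show "(std ` \<Q>, std ` (\<Union>E\<in>\<Q>. \<P> E)) \<in> exp_le" using all(3) eq by simp
  show ne: "(\<Union>E\<in>\<Q>. \<P> E) \<subseteq> ne" using PP_D(3) \<P> \<Q>(3) by blast
  have "std ` (\<Union>E\<in>\<Q>. \<P> E) \<in> PV X S SS Y" using all(1,2) pv(2) eq by (simp add: PV_def)
  then show "finite (\<Union>E\<in>\<Q>. \<P> E)" "partition_on Y (\<Union>E\<in>\<Q>. \<P> E)" using std_PV_iff[OF ne] by auto
qed

text \<open>
  This is where (S5) enters: a piece \<open>f|\<^sub>E\<close> that lies in \<open>SS E (f(E))\<close> exhibits its own class as that of
  the identity of \<open>f(E)\<close>.
\<close>

lemma class_refined_by_std: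
  assumes "b \<in> \<B>"
  shows "\<exists>\<Q>\<subseteq>ne. refinement b (std ` \<Q>)"
proof -
  obtain f D where f: "(f, D) \<in> ld_pairs X S" "b = cl f D" using assms by (rule classesE)
  then have D: "D \<in> ne" "locally_determined X S f D" by (auto simp: ld_pairs_def)
  then obtain \<P> where \<P>: "\<P> \<in> PP D" "\<And>E. E \<in> \<P> \<Longrightarrow> restr f E \<in> S \<and> restr f E \<in> SS E (f `` E)"
    using S5 by blast
  note PP = PP_D[OF D(1) \<P>(1)]
  have *: "f `` E \<in> ne \<and> cl f E = std (f `` E)" if E: "E \<in> \<P>" for E
  proof
    have E': "E \<in> ne" "E \<subseteq> D" using PP(2,3) E by (auto simp: partition_on_def)
    have "f `` E \<in> domains S" using Range_in_domains[of "restr f E"] \<P>(2)[OF E] by (simp add: Range_restr)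
    moreover have "f `` E \<noteq> {}" using ne_domainsD[OF E'(1)] E'(2) f(1) by (auto simp: ld_pairs_iff)
    ultimately show ne: "f `` E \<in> ne" by (simp add: ne_domains_def)
    have "restr f E = restr f E O Id_on (f `` E)" by (rule relcomp_Id_on[symmetric]) (simp add: Range_restr)
    then have "cl (restr f E) E = std (f `` E)"
      using \<P>(2)[OF E] ld_pairs_restr[OF f(1) E'] ld_pairs_Id_on[OF ne] by (intro cls_eqI) auto
    then show "cl f E = std (f `` E)" by (simp add: cls_restr)
  qed
  then have "cl f ` \<P> = std ` (\<lambda>E. f `` E) ` \<P>" by (auto simp: image_image)
  then have "refinement b (std ` (\<lambda>E. f `` E) ` \<P>)"
    unfolding refinement_def using f \<P>(1) by metis
  moreover have "(\<lambda>E. f `` E) ` \<P> \<subseteq> ne" using * by blast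
  ultimately show ?thesis by blast
qed

lemma PV_below_std:
  assumes v: "v \<in> PV X S SS Y"
  obtains \<Q> where "finite \<Q>" "partition_on Y \<Q>" "\<Q> \<subseteq> ne" "\<Q> \<noteq> {}" "(v, std ` \<Q>) \<in> exp_le"
proof -
  have pv: "pv v" "im v = Y" using v by (auto simp: PV_def)
  then have "\<forall>b\<in>v. \<exists>\<Q>. \<Q> \<subseteq> ne \<and> refinement b (std ` \<Q>)"
    using class_refined_by_std by (auto simp: pseudovertex_def)
  from bchoice[OF this]
  obtain Q where Q: "\<forall>b\<in>v. Q b \<subseteq> ne \<and> refinement b (std ` Q b)" ..
  then have all: "\<forall>b\<in>v. refinement b (std ` Q b)" by blast
  have eq: "(\<Union>b\<in>v. std ` Q b) = std ` (\<Union>b\<in>v. Q b)" by blast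
  have ne: "(\<Union>b\<in>v. Q b) \<subseteq> ne" using Q by blast
  have "std ` (\<Union>b\<in>v. Q b) \<in> PV X S SS Y"
    using refine_all(1,2)[OF pv(1) all] pv(2) eq by (simp add: PV_def)
  then have "finite (\<Union>b\<in>v. Q b) \<and> partition_on Y (\<Union>b\<in>v. Q b) \<and> (\<Union>b\<in>v. Q b) \<noteq> {}"
    using std_PV_iff[OF ne] by simp
  moreover have "(v, std ` (\<Union>b\<in>v. Q b)) \<in> exp_le" using refine_all(3)[OF pv(1) all] eq by simp
  ultimately show thesis using ne by (intro that[of "\<Union>b\<in>v. Q b"]) simp_all
qed

text \<open>
  (P5) applied to the partition of \<open>D\<close> into its intersections with the blocks of \<open>\<Q>\<close>.
\<close>

lemma refining_choice:
  assumes Q: "finite \<Q>" "partition_on Y \<Q>" "\<Q> \<subseteq> ne" and D: "D \<in> ne" "D \<subseteq> Y"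
  shows "\<exists>\<P>\<in>PP D. \<forall>E\<in>\<P>. \<exists>F\<in>\<Q>. E \<subseteq> F"
proof -
  let ?R = "restr_partition \<Q> D"
  have R: "?R = (\<lambda>P. P \<inter> D) ` \<Q> - {{}}" by (auto simp: restr_partition_def)
  have "finite ?R" unfolding R using Q(1) by simp
  moreover have "partition_on D ?R"
    unfolding R
  proof (rule partition_onI)
    show "\<Union>((\<lambda>P. P \<inter> D) ` \<Q> - {{}}) = D"
      using partition_onD1[OF Q(2)] D(2) by blast
    fix A B assume "A \<in> (\<lambda>P. P \<inter> D) ` \<Q> - {{}}" "B \<in> (\<lambda>P. P \<inter> D) ` \<Q> - {{}}" "A \<noteq> B"
    then obtain A' B' where "A' \<in> \<Q>" "B' \<in> \<Q>" "A = A' \<inter> D" "B = B' \<inter> D" "A' \<noteq> B'" by blast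
    then show "disjnt A B" using partition_onD2[OF Q(2)] unfolding disjoint_def disjnt_def by blast
  qed blast
  moreover have "?R \<subseteq> domains S"
  proof -
    have "P \<inter> D \<in> domains S" if "P \<in> \<Q>" for P
      using domains_Int ne_domainsD[OF D(1)] ne_domainsD[of P] Q(3) that by blast
    then show ?thesis by (auto simp: restr_partition_def)
  qed
  ultimately obtain \<P> where "\<P> \<in> PP D" "refines D \<P> ?R" using P5[OF D(1)] by blast
  moreover have "\<exists>F\<in>\<Q>. E \<subseteq> F" if "E \<in> \<P>" "refines D \<P> ?R" for E \<P>
  proof -
    obtain F where "F \<in> ?R" "E \<subseteq> F" using \<open>refines D \<P> ?R\<close> \<open>E \<in> \<P>\<close> unfolding refines_def by blast
    then show ?thesis unfolding R by blast
  qed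
  ultimately show ?thesis by blast
qed

lemma simultaneous_refinement:
  assumes Q: "partition_on Y \<Q>" "\<Q> \<subseteq> ne" and Q': "finite \<Q>'" "partition_on Y \<Q>'" "\<Q>' \<subseteq> ne"
  obtains \<P> where "\<forall>D\<in>\<Q>. \<P> D \<in> PP D" "\<forall>D\<in>\<Q>. \<forall>E\<in>\<P> D. \<exists>F\<in>\<Q>'. E \<subseteq> F"
proof -
  have "\<forall>D\<in>\<Q>. \<exists>\<P>. \<P> \<in> PP D \<and> (\<forall>E\<in>\<P>. \<exists>F\<in>\<Q>'. E \<subseteq> F)"
  proof
    fix D assume "D \<in> \<Q>"
    then have "D \<in> ne" "D \<subseteq> Y" using Q(2) partition_onD1[OF Q(1)] by auto
    from refining_choice[OF Q' this] show "\<exists>\<P>. \<P> \<in> PP D \<and> (\<forall>E\<in>\<P>. \<exists>F\<in>\<Q>'. E \<subseteq> F)"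
      by (simp only: Bex_def)
  qed
  from bchoice[OF this]
  obtain \<P> where "\<forall>D\<in>\<Q>. \<P> D \<in> PP D \<and> (\<forall>E\<in>\<P> D. \<exists>F\<in>\<Q>'. E \<subseteq> F)" ..
  then show thesis by (intro that[of \<P>]) simp_all
qed

lemma partition_on_unique: "partition_on Y \<Q> \<Longrightarrow> E \<in> \<Q> \<Longrightarrow> F \<in> \<Q> \<Longrightarrow> A \<subseteq> E \<Longrightarrow> A \<subseteq> F \<Longrightarrow> A \<noteq> {} \<Longrightarrow> E = F"
  unfolding partition_on_def disjoint_def by blast

text \<open>
  \<open>\<Q>\<close> is refined to \<open>\<A>\<close>, whose blocks lie in blocks of \<open>\<Q>'\<close>, and \<open>\<Q>'\<close> to \<open>\<R>\<close>, whose blocks lie in blocks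
  of \<open>\<A>\<close>. By (P3), \<open>\<R>\<close> is also a refinement of \<open>\<A>\<close> along members of \<open>PP\<close>, and so it is reached from both
  sides.
\<close>

lemma std_common_upper_bound:
  assumes Q: "finite \<Q>" "partition_on Y \<Q>" "\<Q> \<subseteq> ne" "\<Q> \<noteq> {}"
    and Q': "finite \<Q>'" "partition_on Y \<Q>'" "\<Q>' \<subseteq> ne" "\<Q>' \<noteq> {}"
  shows "\<exists>w\<in>PV X S SS Y. (std ` \<Q>, w) \<in> exp_le \<and> (std ` \<Q>', w) \<in> exp_le"
proof -
  obtain \<P> where \<P>: "\<forall>D\<in>\<Q>. \<P> D \<in> PP D" and \<P>0: "\<forall>D\<in>\<Q>. \<forall>E\<in>\<P> D. \<exists>F\<in>\<Q>'. E \<subseteq> F"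
    using simultaneous_refinement[OF Q(2,3) Q'(1-3)] .
  define \<A> where "\<A> = (\<Union>D\<in>\<Q>. \<P> D)"
  have A: "(std ` \<Q>, std ` \<A>) \<in> exp_le" "finite \<A>" "partition_on Y \<A>" "\<A> \<subseteq> ne"
    unfolding \<A>_def using std_refine_all[OF Q \<P>] by simp_all
  have "\<A> \<noteq> {}"
  proof -
    obtain D where "D \<in> \<Q>" using Q(4) by blast
    then have "\<P> D \<noteq> {}" using PP_D(4)[of D "\<P> D"] \<P> Q(3) by blast
    then show ?thesis unfolding \<A>_def using \<open>D \<in> \<Q>\<close> by blast
  qed
  have "\<forall>D\<in>\<A>. \<exists>F. F \<in> \<Q>' \<and> D \<subseteq> F" using \<P>0 unfolding \<A>_def by blast
  from bchoice[OF this] obtain G where "\<forall>D\<in>\<A>. G D \<in> \<Q>' \<and> D \<subseteq> G D" ..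
  then have G: "G D \<in> \<Q>' \<and> D \<subseteq> G D" if "D \<in> \<A>" for D using that by blast
  obtain \<P>' where P'_all: "\<forall>F\<in>\<Q>'. \<P>' F \<in> PP F" and "\<forall>F\<in>\<Q>'. \<forall>E\<in>\<P>' F. \<exists>D\<in>\<A>. E \<subseteq> D"
    using simultaneous_refinement[OF Q'(2,3) A(2-4)] .
  then have \<P>': "F \<in> \<Q>' \<Longrightarrow> \<P>' F \<in> PP F"
    "F \<in> \<Q>' \<Longrightarrow> E \<in> \<P>' F \<Longrightarrow> \<exists>D\<in>\<A>. E \<subseteq> D" for F E by auto
  define \<R> where "\<R> = (\<Union>F\<in>\<Q>'. \<P>' F)"
  have R: "(std ` \<Q>', std ` \<R>) \<in> exp_le" "finite \<R>" "partition_on Y \<R>" "\<R> \<subseteq> ne"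
    unfolding \<R>_def using std_refine_all[OF Q' P'_all] by simp_all
  have "Y \<noteq> {}"
    using partition_onD1[OF A(3)] partition_onD3[OF A(3)] \<open>\<A> \<noteq> {}\<close> by auto
  then have R_ne: "\<R> \<noteq> {}" using partition_onD1[OF R(3)] by auto
  define \<P>'' where "\<P>'' = (\<lambda>D. restr_partition (\<P>' (G D)) D)"
  have P'': "\<P>'' D \<in> PP D" if D: "D \<in> \<A>" for D
    unfolding \<P>''_def using G[OF D] Q'(3) A(4) D by (intro P3[OF _ \<P>'(1)]) auto
  \<comment> \<open>Restricting to \<open>D\<close> does not cut any block of \<open>\<R>\<close>: a block that meets \<open>D\<close> lies in a block of \<open>\<A>\<close>, which must be \<open>D\<close>.\<close>
  have P''_eq: "\<P>'' D = {E \<in> \<R>. E \<subseteq> D}" if D: "D \<in> \<A>" for D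
  proof (rule subset_antisym; rule subsetI)
    fix E assume "E \<in> \<P>'' D"
    then obtain E' where E': "E' \<in> \<P>' (G D)" "E = E' \<inter> D" "E \<noteq> {}"
      unfolding \<P>''_def restr_partition_def by blast
    obtain D' where D': "D' \<in> \<A>" "E' \<subseteq> D'" using \<P>'(2) G[OF D] E'(1) by blast
    then have "D = D'" using E' D by (intro partition_on_unique[OF A(3), of D D' E]) auto
    then have "E = E'" using E'(2) D'(2) by blast
    then show "E \<in> {E \<in> \<R>. E \<subseteq> D}" using E' G[OF D] unfolding \<R>_def by blast
  next
    fix E assume "E \<in> {E \<in> \<R>. E \<subseteq> D}"
    then obtain F where F: "F \<in> \<Q>'" "E \<in> \<P>' F" "E \<subseteq> D" unfolding \<R>_def by blast
    have FE: "F \<in> ne" "E \<subseteq> F" "E \<noteq> {}"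
      using PP_D(2)[OF _ \<P>'(1)[OF F(1)]] F(1,2) Q'(3) unfolding partition_on_def by blast+
    have "F = G D"
      using F FE G[OF D] by (intro partition_on_unique[OF Q'(2), of F "G D" E]) auto
    then show "E \<in> \<P>'' D" using F FE unfolding \<P>''_def restr_partition_def by blast
  qed
  have "(\<Union>D\<in>\<A>. \<P>'' D) = \<R>"
  proof -
    have "\<exists>D\<in>\<A>. E \<subseteq> D" if "E \<in> \<R>" for E using that \<P>'(2) unfolding \<R>_def by blast
    then show ?thesis using P''_eq by blast
  qed
  then have "(std ` \<A>, std ` \<R>) \<in> exp_le"
    using std_refine_all(1)[OF A(2-4) \<open>\<A> \<noteq> {}\<close>, of \<P>''] P'' by simp
  then have "(std ` \<Q>, std ` \<R>) \<in> exp_le" using A(1) exp_le_trans by blast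
  moreover have "std ` \<R> \<in> PV X S SS Y" using std_PV_iff[OF R(4)] R(2,3) R_ne by blast
  ultimately show ?thesis using R(1) by blast
qed

lemma PV_directed:
  assumes "v \<in> PV X S SS Y" "w \<in> PV X S SS Y"
  shows "\<exists>z\<in>PV X S SS Y. (v, z) \<in> exp_le \<and> (w, z) \<in> exp_le"
proof -
  obtain \<Q> where Q: "finite \<Q>" "partition_on Y \<Q>" "\<Q> \<subseteq> ne" "\<Q> \<noteq> {}" "(v, std ` \<Q>) \<in> exp_le"
    using PV_below_std[OF assms(1)] .
  obtain \<Q>' where Q': "finite \<Q>'" "partition_on Y \<Q>'" "\<Q>' \<subseteq> ne" "\<Q>' \<noteq> {}" "(w, std ` \<Q>') \<in> exp_le"
    using PV_below_std[OF assms(2)] .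
  show ?thesis
    using std_common_upper_bound[OF Q(1-4) Q'(1-4)] Q(5) Q'(5) exp_le_trans by blast
qed

lemma PV_nonempty:
  assumes "Y \<noteq> {}" "finite_disjoint_union_of_domains S Y"
  shows "PV X S SS Y \<noteq> {}"
proof -
  obtain \<Q> where "finite \<Q>" "partition_on Y \<Q>" "\<Q> \<subseteq> ne"
    using finite_disjoint_union_of_domainsD[OF assms(2)] .
  moreover from this have "\<Q> \<noteq> {}" using assms(1) partition_onD1 by force
  ultimately show ?thesis using std_PV_iff by blast
qed

end

section \<open>The action of the group\<close>

text \<open>
  The action on single classes. Composing every representative with \<open>\<gamma>\<close> gives all of the new class when
  \<open>\<gamma>\<close> is invertible, so no representative has to be chosen.
\<close>

definition translate :: "('a \<times> 'a) set \<Rightarrow> 'a pair_class \<Rightarrow> 'a pair_class" where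
  "translate \<gamma> b = (\<lambda>(f, D). (f O \<gamma>, D)) ` b"

lemma translate_translate: "translate \<delta> (translate \<gamma> b) = translate (\<gamma> O \<delta>) b"
  by (simp add: translate_def image_image case_prod_unfold O_assoc)

context S_structure
begin

abbreviation "\<Gamma> \<equiv> carrier (GammaS X S)"

lemma GammaS_D:
  assumes "\<gamma> \<in> \<Gamma>"
  shows "\<gamma> \<in> hat X S" "Domain \<gamma> = X" "Range \<gamma> = X" "partial_bij X \<gamma>" "\<gamma>\<inverse> \<in> \<Gamma>"
    "\<gamma> O \<gamma>\<inverse> = Id_on X" "\<gamma>\<inverse> O \<gamma> = Id_on X"
proof -
  show \<gamma>: "\<gamma> \<in> hat X S" "Domain \<gamma> = X" "Range \<gamma> = X" "partial_bij X \<gamma>"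
    using assms hat_partial_bij by (simp_all add: carrier_GammaS)
  show "\<gamma>\<inverse> \<in> \<Gamma>" using \<gamma> hat_converse by (simp add: carrier_GammaS)
  show "\<gamma> O \<gamma>\<inverse> = Id_on X" "\<gamma>\<inverse> O \<gamma> = Id_on X"
    using partial_bij_relcomp_converse[OF \<gamma>(4)] partial_bij_converse_relcomp[OF \<gamma>(4)] \<gamma>(2,3) by simp_all
qed

lemma ld_pairs_Range: "(f, D) \<in> ld_pairs X S \<Longrightarrow> Range f \<subseteq> X"
  using hat_partial_bij[of f] by (auto simp: ld_pairs_iff partial_bij_def)

lemma ld_pairs_postcomp:
  assumes "\<gamma> \<in> \<Gamma>" "(f, D) \<in> ld_pairs X S"
  shows "(f O \<gamma>, D) \<in> ld_pairs X S"
proof -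
  have "Domain (f O \<gamma>) = Domain f"
    using ld_pairs_Range[OF assms(2)] GammaS_D(2)[OF assms(1)] by (intro Domain_relcomp_eq) simp
  then show ?thesis
    using assms(2) hat_comp[OF _ GammaS_D(1)[OF assms(1)]] by (simp add: ld_pairs_iff)
qed

text \<open>
  Precomposition with \<open>h\<close>, which defines the equivalence of pairs, commutes with postcomposition with
  \<open>\<gamma>\<close>.
\<close>

lemma translate_cls:
  assumes \<gamma>: "\<gamma> \<in> \<Gamma>" and f: "(f, D) \<in> ld_pairs X S"
  shows "translate \<gamma> (cl f D) = cl (f O \<gamma>) D"
proof (rule subset_antisym; rule subsetI)
  note f\<gamma> = ld_pairs_postcomp[OF \<gamma> f]
  fix p assume "p \<in> translate \<gamma> (cl f D)"
  then obtain g E where g: "(g, E) \<in> cl f D" "p = (g O \<gamma>, E)" by (auto simp: translate_def)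
  then obtain h where h: "(g, E) \<in> ld_pairs X S" "h \<in> SS E D" "g = h O f"
    unfolding mem_cls_iff[OF f] by blast
  then show "p \<in> cl (f O \<gamma>) D"
    unfolding g(2) mem_cls_iff[OF f\<gamma>] using ld_pairs_postcomp[OF \<gamma>] O_assoc by blast
next
  note f\<gamma> = ld_pairs_postcomp[OF \<gamma> f]
  fix p assume p: "p \<in> cl (f O \<gamma>) D"
  obtain g E where gE: "p = (g, E)" by fastforce
  obtain h where h: "(g, E) \<in> ld_pairs X S" "h \<in> SS E D" "g = h O (f O \<gamma>)"
    using p unfolding gE mem_cls_iff[OF f\<gamma>] by blast
  have ne: "E \<in> ne" "D \<in> ne" using h(1) f by (simp_all add: ld_pairs_iff)
  note hD = SS_D[OF ne h(2)]
  have "(h O f, E) \<in> ld_pairs X S" by (rule ld_pairs_precomp[OF f hD(1-3) ne(1)])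
  then have "(h O f, E) \<in> cl f D" unfolding mem_cls_iff[OF f] using h(2) by blast
  moreover have "p = (\<lambda>(f, D). (f O \<gamma>, D)) (h O f, E)" using gE h(3) by (simp add: O_assoc)
  ultimately show "p \<in> translate \<gamma> (cl f D)" unfolding translate_def by (rule rev_image_eqI)
qed

lemma translate_class:
  assumes \<gamma>: "\<gamma> \<in> \<Gamma>" and b: "b \<in> \<B>"
  shows "translate \<gamma> b \<in> \<B>" "class_im (translate \<gamma> b) = \<gamma> `` class_im b"
proof -
  obtain f D where f: "(f, D) \<in> ld_pairs X S" "b = cl f D" using b by (rule classesE)
  note f\<gamma> = ld_pairs_postcomp[OF \<gamma> f(1)]
  show "translate \<gamma> b \<in> \<B>"
    unfolding f(2) translate_cls[OF \<gamma> f(1)] using f\<gamma> by (rule cls_in_classes)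
  show "class_im (translate \<gamma> b) = \<gamma> `` class_im b"
    unfolding f(2) translate_cls[OF \<gamma> f(1)] class_im_cls[OF f(1)] class_im_cls[OF f\<gamma>] by blast
qed

lemma translate_Id:
  assumes "b \<in> \<B>"
  shows "translate (Id_on X) b = b"
proof -
  obtain f D where f: "(f, D) \<in> ld_pairs X S" "b = cl f D" using assms by (rule classesE)
  have "Id_on X \<in> \<Gamma>" using Id_on_X_in_hat by (simp add: carrier_GammaS)
  then show ?thesis
    unfolding f(2) using translate_cls[OF _ f(1)] relcomp_Id_on[OF ld_pairs_Range[OF f(1)]] by simp
qed

lemma translate_inverse:
  assumes "\<gamma> \<in> \<Gamma>" "b \<in> \<B>"
  shows "translate (\<gamma>\<inverse>) (translate \<gamma> b) = b" "translate \<gamma> (translate (\<gamma>\<inverse>) b) = b"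
  using assms by (simp_all add: translate_translate GammaS_D translate_Id)

lemma act_eq_translate:
  assumes \<gamma>: "\<gamma> \<in> \<Gamma>" and v: "v \<subseteq> \<B>"
  shows "act X S SS \<gamma> v = translate \<gamma> ` v"
proof (rule subset_antisym; rule subsetI)
  fix b assume "b \<in> act X S SS \<gamma> v"
  then obtain f D where "(f, D) \<in> ld_pairs X S" "cl f D \<in> v" "b = cl (f O \<gamma>) D"
    unfolding act_def by blast
  then show "b \<in> translate \<gamma> ` v" using translate_cls[OF \<gamma>] by (intro image_eqI) auto
next
  fix b assume "b \<in> translate \<gamma> ` v"
  then obtain c where c: "c \<in> v" "b = translate \<gamma> c" by blast
  then have "c \<in> \<B>" using v by blast
  then obtain f D where "(f, D) \<in> ld_pairs X S" "c = cl f D" by (rule classesE)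
  then show "b \<in> act X S SS \<gamma> v" unfolding act_def using c translate_cls[OF \<gamma>] by blast
qed

lemma act_pv:
  assumes \<gamma>: "\<gamma> \<in> \<Gamma>" and v: "pv v"
  shows "act X S SS \<gamma> v = translate \<gamma> ` v" "pv (act X S SS \<gamma> v)" "im (act X S SS \<gamma> v) = \<gamma> `` im v"
proof -
  have vD: "finite v" "v \<noteq> {}" "v \<subseteq> \<B>" "disjoint_family_on class_im v"
    using v by (auto simp: pseudovertex_def)
  show eq: "act X S SS \<gamma> v = translate \<gamma> ` v" by (rule act_eq_translate[OF \<gamma> vD(3)])
  have t: "translate \<gamma> b \<in> \<B>" "class_im (translate \<gamma> b) = \<gamma> `` class_im b" if "b \<in> v" for b
    using translate_class[OF \<gamma>] vD(3) that by auto
  have "disjoint_family_on class_im (translate \<gamma> ` v)"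
    unfolding disjoint_family_on_def
  proof (intro ballI impI)
    fix c d assume "c \<in> translate \<gamma> ` v" "d \<in> translate \<gamma> ` v" "c \<noteq> d"
    then obtain c' d' where cd: "c' \<in> v" "d' \<in> v" "c = translate \<gamma> c'" "d = translate \<gamma> d'" "c' \<noteq> d'"
      by blast
    then have "class_im c' \<inter> class_im d' = {}" using vD(4) unfolding disjoint_family_on_def by blast
    then show "class_im c \<inter> class_im d = {}"
      using cd t partial_bij_Image_disjoint[OF GammaS_D(4)[OF \<gamma>]] by simp
  qed
  then show "pv (act X S SS \<gamma> v)"
    unfolding eq pseudovertex_def using vD t by auto
  show "im (act X S SS \<gamma> v) = \<gamma> `` im v"
    unfolding eq im_def using t by (simp add: Image_UN)
qed

text \<open>
  The expansion of the translate uses the same \<open>h\<close> and \<open>\<P>\<close>, with \<open>f O \<gamma>\<close> in place of \<open>f\<close>. Removing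
  \<open>[f, D]\<close> commutes with translation because translation is injective on classes.
\<close>

lemma act_expansion:
  assumes \<gamma>: "\<gamma> \<in> \<Gamma>" and vw: "(v, w) \<in> expansion X S SS PP"
  shows "(act X S SS \<gamma> v, act X S SS \<gamma> w) \<in> expansion X S SS PP"
proof -
  obtain f D D' h \<P> where f: "(f, D) \<in> ld_pairs X S" "cl f D \<in> v"
    and h: "D' \<in> ne" "h \<in> SS D' D" and \<P>: "\<P> \<in> PP D'" "2 \<le> card \<P>"
    and w: "w = (v - {cl f D}) \<union> {cl (h O f) E |E. E \<in> \<P>}" and pv: "pv v" "pv w"
    using vw unfolding expansion_def mem_Collect_eq case_prod_conv by (elim conjE exE) (rule that)
  have D: "D \<in> ne" using f(1) by (simp add: ld_pairs_iff)
  note hD = SS_D[OF h(1) D h(2)]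
  have hf: "(h O f, D') \<in> ld_pairs X S" by (rule ld_pairs_precomp[OF f(1) hD(1-3) h(1)])
  note PP = PP_D[OF h(1) \<P>(1)]
  have piece: "translate \<gamma> (cl (h O f) E) = cl (h O (f O \<gamma>)) E" if "E \<in> \<P>" for E
  proof -
    have E: "E \<in> ne" "E \<subseteq> D'" using PP(2,3) that by (auto simp: partition_on_def)
    have "translate \<gamma> (cl (h O f) E) = translate \<gamma> (cl (restr (h O f) E) E)"
      by (simp add: cls_restr)
    also have "\<dots> = cl (restr (h O f) E O \<gamma>) E"
      by (rule translate_cls[OF \<gamma> ld_pairs_restr[OF hf E]])
    also have "\<dots> = cl (h O (f O \<gamma>)) E"
      unfolding restr_relcomp by (simp add: cls_restr O_assoc)
    finally show ?thesis .
  qed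
  have vB: "v \<subseteq> \<B>" using pv(1) by (simp add: pseudovertex_def)
  have inj: "inj_on (translate \<gamma>) v"
    using translate_inverse(1)[OF \<gamma>] vB by (intro inj_on_inverseI[of v "translate (\<gamma>\<inverse>)"]) auto
  have "translate \<gamma> ` (v - {cl f D}) = translate \<gamma> ` v - translate \<gamma> ` {cl f D}"
    using f(2) by (intro inj_on_image_set_diff[OF inj]) auto
  also have "translate \<gamma> ` {cl f D} = {cl (f O \<gamma>) D}" using translate_cls[OF \<gamma> f(1)] by simp
  finally have diff: "translate \<gamma> ` (v - {cl f D}) = translate \<gamma> ` v - {cl (f O \<gamma>) D}" .
  have "translate \<gamma> ` {cl (h O f) E |E. E \<in> \<P>} = {cl (h O (f O \<gamma>)) E |E. E \<in> \<P>}"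
    using piece by (auto simp: Setcompr_eq_image image_image)
  then have "translate \<gamma> ` w = (translate \<gamma> ` v - {cl (f O \<gamma>) D}) \<union> {cl (h O (f O \<gamma>)) E |E. E \<in> \<P>}"
    unfolding w image_Un diff by simp
  then have "act X S SS \<gamma> w = (act X S SS \<gamma> v - {cl (f O \<gamma>) D}) \<union> {cl (h O (f O \<gamma>)) E |E. E \<in> \<P>}"
    using act_pv(1)[OF \<gamma>] pv by simp
  moreover have "cl (f O \<gamma>) D \<in> act X S SS \<gamma> v"
    unfolding act_def using f by blast
  ultimately show ?thesis
    unfolding expansion_def mem_Collect_eq case_prod_conv
    using act_pv(2)[OF \<gamma> pv(1)] act_pv(2)[OF \<gamma> pv(2)] ld_pairs_postcomp[OF \<gamma> f(1)] h \<P>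
    by (intro conjI exI[of _ "f O \<gamma>"] exI[of _ D] exI[of _ D'] exI[of _ h] exI[of _ \<P>])
qed

lemma act_exp_le:
  assumes "\<gamma> \<in> \<Gamma>" "(v, w) \<in> exp_le"
  shows "(act X S SS \<gamma> v, act X S SS \<gamma> w) \<in> exp_le"
  using assms(2) unfolding expansion_le_def
  by (induction rule: rtrancl_induct) (auto intro: rtrancl_into_rtrancl act_expansion[OF assms(1)])

lemma VS_D: "v \<in> VS X S SS \<Longrightarrow> pv v \<and> im v = X"
  by (simp add: VS_def PV_def)

lemma act_VS:
  assumes \<gamma>: "\<gamma> \<in> \<Gamma>" and v: "v \<in> VS X S SS"
  shows "act X S SS \<gamma> v \<in> VS X S SS"
proof -
  have "\<gamma> `` X = X" using GammaS_D(2,3)[OF \<gamma>] by blast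
  then show ?thesis using act_pv[OF \<gamma>, of v] VS_D[OF v] by (simp add: VS_def PV_def)
qed

lemma act_act:
  assumes "\<gamma> \<in> \<Gamma>" "\<delta> \<in> \<Gamma>" "v \<in> VS X S SS"
  shows "act X S SS \<delta> (act X S SS \<gamma> v) = act X S SS (\<gamma> O \<delta>) v"
proof -
  have "\<gamma> O \<delta> \<in> \<Gamma>"
    using group.is_monoid[OF GammaS_group] assms monoid.m_closed[of "GammaS X S" \<delta> \<gamma>] by (simp add: GammaS_def)
  moreover have "pv v" "pv (act X S SS \<gamma> v)" using VS_D act_VS assms by blast+
  ultimately show ?thesis
    using assms act_pv(1) by (simp add: image_image translate_translate)
qed

lemma act_Id: "v \<in> VS X S SS \<Longrightarrow> act X S SS (Id_on X) v = v"
proof -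
  assume "v \<in> VS X S SS"
  then have v: "pv v" "v \<subseteq> \<B>" using VS_D by (auto simp: pseudovertex_def)
  have "Id_on X \<in> \<Gamma>" using Id_on_X_in_hat by (simp add: carrier_GammaS)
  then have "act X S SS (Id_on X) v = translate (Id_on X) ` v" using act_pv(1) v(1) by blast
  also have "\<dots> = (\<lambda>b. b) ` v" using translate_Id v(2) by (intro image_cong) auto
  finally show ?thesis by simp
qed

lemma act_group_action:
  "group_action (GammaS X S) (VS X S SS) (\<lambda>\<gamma>. restrict (act X S SS \<gamma>) (VS X S SS))"
proof -
  let ?V = "VS X S SS" and ?\<phi> = "\<lambda>\<gamma>. restrict (act X S SS \<gamma>) (VS X S SS)"
  have Bij: "?\<phi> \<gamma> \<in> Bij ?V" if \<gamma>: "\<gamma> \<in> \<Gamma>" for \<gamma>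
  proof -
    note \<gamma>' = GammaS_D(5)[OF \<gamma>]
    have "bij_betw (act X S SS \<gamma>) ?V ?V"
    proof (rule bij_betw_byWitness[where f' = "act X S SS (\<gamma>\<inverse>)"])
      show "\<forall>v\<in>?V. act X S SS (\<gamma>\<inverse>) (act X S SS \<gamma> v) = v"
        using act_act[OF \<gamma> \<gamma>'] GammaS_D(6)[OF \<gamma>] act_Id by simp
      show "\<forall>v\<in>?V. act X S SS \<gamma> (act X S SS (\<gamma>\<inverse>) v) = v"
        using act_act[OF \<gamma>' \<gamma>] GammaS_D(7)[OF \<gamma>] act_Id by simp
      show "act X S SS \<gamma> ` ?V \<subseteq> ?V" "act X S SS (\<gamma>\<inverse>) ` ?V \<subseteq> ?V"
        using act_VS[OF \<gamma>] act_VS[OF \<gamma>'] by auto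
    qed
    then show ?thesis by (simp add: Bij_def)
  qed
  have "?\<phi> \<in> hom (GammaS X S) (BijGroup ?V)"
  proof (rule homI)
    show "?\<phi> \<gamma> \<in> carrier (BijGroup ?V)" if "\<gamma> \<in> \<Gamma>" for \<gamma>
      using Bij[OF that] by (simp add: BijGroup_def)
    fix \<gamma> \<delta> assume \<gamma>\<delta>: "\<gamma> \<in> \<Gamma>" "\<delta> \<in> \<Gamma>"
    have "?\<phi> (\<gamma> \<otimes>\<^bsub>GammaS X S\<^esub> \<delta>) = compose ?V (?\<phi> \<gamma>) (?\<phi> \<delta>)"
    proof
      fix v
      show "?\<phi> (\<gamma> \<otimes>\<^bsub>GammaS X S\<^esub> \<delta>) v = compose ?V (?\<phi> \<gamma>) (?\<phi> \<delta>) v"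
        using act_act[OF \<gamma>\<delta>(2,1), of v] act_VS[OF \<gamma>\<delta>(2), of v]
        by (simp add: GammaS_def compose_def)
    qed
    then show "?\<phi> (\<gamma> \<otimes>\<^bsub>GammaS X S\<^esub> \<delta>) = ?\<phi> \<gamma> \<otimes>\<^bsub>BijGroup ?V\<^esub> ?\<phi> \<delta>"
      using Bij[OF \<gamma>\<delta>(1)] Bij[OF \<gamma>\<delta>(2)] by (simp add: BijGroup_def)
  qed
  then show ?thesis
    unfolding group_action_def group_hom_def group_hom_axioms_def
    using GammaS_group group_BijGroup by blast
qed

lemma act_order_complex:
  assumes \<gamma>: "\<gamma> \<in> \<Gamma>" and \<sigma>: "\<sigma> \<in> order_complex (VS X S SS) exp_le"
  shows "restrict (act X S SS \<gamma>) (VS X S SS) ` \<sigma> \<in> order_complex (VS X S SS) exp_le"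
proof -
  have \<sigma>D: "\<sigma> \<subseteq> VS X S SS" "finite \<sigma>" "\<sigma> \<noteq> {}" "\<sigma> \<in> Chains exp_le"
    using \<sigma> by (auto simp: order_complex_def)
  have eq: "restrict (act X S SS \<gamma>) (VS X S SS) ` \<sigma> = act X S SS \<gamma> ` \<sigma>"
    using \<sigma>D(1) by (intro image_cong) auto
  have "act X S SS \<gamma> ` \<sigma> \<in> Chains exp_le"
    using \<sigma>D(4) act_exp_le[OF \<gamma>] unfolding Chains_def by blast
  then show ?thesis
    unfolding eq order_complex_def using \<sigma>D act_VS[OF \<gamma>] by auto
qed

lemma contractible_PV:
  assumes "Y \<noteq> {}" "finite_disjoint_union_of_domains S Y"
  shows "contractible_complex (order_complex (PV X S SS Y) exp_le)"
proof (rule contractible_order_complex_directed)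
  show "trans exp_le" unfolding expansion_le_def by (rule trans_rtrancl)
  show "PV X S SS Y \<noteq> {}" by (rule PV_nonempty[OF assms])
qed (use exp_le_refl PV_directed in auto)

end

theorem theorem5p2:
  fixes X :: "'a set" and S :: "('a \<times> 'a) set set"
    and SS :: "'a set \<Rightarrow> 'a set \<Rightarrow> ('a \<times> 'a) set set"
    and PP :: "'a set \<Rightarrow> 'a set set set"
  assumes "S_structure X S SS PP"
  shows "G_complex (GammaS X S) (VS X S SS)
           (order_complex (VS X S SS) (expansion_le X S SS PP))
           (\<lambda>\<gamma>. restrict (act X S SS \<gamma>) (VS X S SS)) \<and>
         contractible_complex (order_complex (VS X S SS) (expansion_le X S SS PP)) \<and>
         (\<forall>Y. Y \<noteq> {} \<and> Y \<subseteq> X \<and> finite_disjoint_union_of_domains S Y \<longrightarrow>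
            contractible_complex (order_complex (PV X S SS Y) (expansion_le X S SS PP)))"
proof -
  interpret S_structure X S SS PP by (rule assms)
  have "G_complex (GammaS X S) (VS X S SS) (order_complex (VS X S SS) exp_le)
      (\<lambda>\<gamma>. restrict (act X S SS \<gamma>) (VS X S SS))"
    unfolding G_complex_def
    using abstract_complex_order_complex[of "VS X S SS" exp_le] exp_le_refl GammaS_group act_group_action
      act_order_complex by simp
  moreover have "contractible_complex (order_complex (VS X S SS) exp_le)"
    unfolding VS_def by (rule contractible_PV[OF X_nonempty X_union_of_domains])
  ultimately show ?thesis using contractible_PV by blast
qed

end
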